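(* Let $Z \in M_n(\mathbb{C})$ be a strict contraction and let $\Lambda \in M_n(\mathbb{C})$. There is an analytic function $f: \mathbb{D} \rightarrow \overline{\mathbb{D}}$ such that $f(Z)=\Lambda$ if and only if $L_\Lambda \circ L_Z^{-1}$ is a completely positive map on $M_n(\mathbb{C})$.
   Context: $\mathbb{D}$ is the open unit disk in $\mathbb{C}$ and $\overline{\mathbb{D}}$ its closure. For $X \in M_n(\mathbb{C})$, the Lyapunov map $L_X : M_n(\mathbb{C}) \to M_n(\mathbb{C})$ is $L_X(H) = H - X^*HX$. A strict contraction is a matrix with operator norm $<1$; for such $Z$ the map $L_Z$ is invertible, with $L_Z^{-1}(H)=\sum_{k\ge 0} (Z^* )^k H Z^k$. $f(Z)$ is defined by the holomorphic functional calculus. A linear map $\varphi$ between $C^*$-algebras is completely positive if for every $k$ the entrywise map $\varphi^{(k)}([m_{ij}])=[\varphi(m_{ij})]$ on $k\times k$ matrices takes positive semidefinite elements to positive semidefinite elements. *)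

theory Defs
  imports "HOL-Complex_Analysis.Complex_Analysis"
begin

definition cadjoint :: "complex^'n^'m \<Rightarrow> complex^'m^'n" where
  "cadjoint A = transpose (map_matrix cnj A)"

(* norm on complex^'n is the Euclidean norm, so the onorm below is the operator (spectral) norm. *)
definition strict_contraction :: "complex^'n^'n \<Rightarrow> bool" where
  "strict_contraction A \<longleftrightarrow> onorm ((*v) A) < 1"

definition lyapunov :: "complex^'n^'n \<Rightarrow> complex^'n^'n \<Rightarrow> complex^'n^'n" where
  "lyapunov X H = H - cadjoint X ** H ** X"

definition spectrum :: "complex^'n^'n \<Rightarrow> complex set" where
  "spectrum A = {z. \<not> invertible (mat z - A)}"

text \<open>
  A contour admissible for the functional calculus of functions holomorphic on \<open>U\<close>: it runs in
  \<open>U\<close>, winds exactly once around every point of the spectrum and not at all around points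
  outside \<open>U\<close>.
\<close>
definition calculus_contour ::
    "complex set \<Rightarrow> complex^'n^'n \<Rightarrow> (real \<Rightarrow> complex) \<Rightarrow> bool" where
  "calculus_contour U A \<gamma> \<longleftrightarrow>
     valid_path \<gamma> \<and> pathfinish \<gamma> = pathstart \<gamma> \<and> path_image \<gamma> \<subseteq> U - spectrum A \<and>
     (\<forall>w\<in>spectrum A. winding_number \<gamma> w = 1) \<and> (\<forall>w. w \<notin> U \<longrightarrow> winding_number \<gamma> w = 0)"

text \<open>
  The holomorphic (Riesz--Dunford) functional calculus: the matrix integral of
  \<open>f z (z I - A)\<^sup>-\<^sup>1\<close> over \<open>\<gamma>\<close>, divided by \<open>2 \<pi> \<i>\<close>, taken entrywise. By Cauchy's theorem
  the value does not depend on the admissible contour chosen. For \<open>U\<close> the unit disk and the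
  spectrum inside \<open>U\<close>, circles about 0 of radius below 1 and close to 1 are admissible.
\<close>
definition hol_calculus ::
    "complex set \<Rightarrow> (complex \<Rightarrow> complex) \<Rightarrow> complex^'n^'n \<Rightarrow> complex^'n^'n" where
  "hol_calculus U f A =
     (let \<gamma> = (SOME \<gamma>. calculus_contour U A \<gamma>) in
      \<chi> i j. 1 / (2 * of_real pi * \<i>) *
        contour_integral \<gamma> (\<lambda>z. f z * matrix_inv (mat z - A) $ i $ j))"

text \<open>
  Elements of \<open>M\<^sub>k(M\<^sub>n(\<complex>))\<close> are represented by functions \<open>M\<close> of two indices, of which only the
  values with \<open>i, j < k\<close> matter. Such an \<open>M\<close> acts on the \<open>k\<close>-fold direct sum of \<open>complex^'n\<close>;
  it is positive semidefinite if \<open>\<langle>M x, x\<rangle>\<close> is real and nonnegative for all \<open>x = (x\<^sub>i)\<^sub>i\<^sub><\<^sub>k\<close>.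
\<close>
definition block_psd :: "nat \<Rightarrow> (nat \<Rightarrow> nat \<Rightarrow> complex^'n^'n) \<Rightarrow> bool" where
  "block_psd k M \<longleftrightarrow>
     (\<forall>x :: nat \<Rightarrow> complex^'n.
        (\<Sum>i<k. \<Sum>a\<in>UNIV. cnj (x i $ a) * (\<Sum>j<k. M i j *v x j) $ a) \<in> \<real>\<^sub>\<ge>\<^sub>0)"

text \<open>
  Complex linearity is part of the definition; it is spelled out through an explicit complex
  scalar multiplication, since the type class one on matrices is over the reals.
\<close>
definition cscale :: "complex \<Rightarrow> complex^'n^'m \<Rightarrow> complex^'n^'m" where
  "cscale c = map_matrix ((*) c)"

definition completely_positive :: "(complex^'n^'n \<Rightarrow> complex^'m^'m) \<Rightarrow> bool" where
  "completely_positive \<phi> \<longleftrightarrow>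
     Vector_Spaces.linear cscale cscale \<phi> \<and>
     (\<forall>k M. block_psd k M \<longrightarrow> block_psd k (\<lambda>i j. \<phi> (M i j)))"

end

theory Submission
  imports Defs "HOL-Real_Asymp.Real_Asymp"
begin

unbundle no Formal_Power_Series.fps_syntax

text \<open>
  Suppose \<open>\<Lambda> = f(Z)\<close> and let \<open>H\<close> be positive semidefinite, with \<open>L\<^sub>Z P = H\<close>. Writing \<open>H\<close> as a sum of
  squares of functionals \<open>l\<close>, the form of \<open>P\<close> at \<open>x\<close> is the sum of all \<open>|y\<^sub>k|\<^sup>2\<close> with \<open>y\<^sub>k = l(Z^k x)\<close>.
  Replacing \<open>x\<close> by \<open>\<Lambda>x\<close> applies to these sequences the adjoint-type Toeplitz operator
  \<open>y \<mapsto> (\<Sum>j. f\<^sub>j y\<^sub>m\<^sub>+\<^sub>j)\<^sub>m\<close>, which is a contraction because \<open>|f| \<le> 1\<close> (Parseval at roots of unity).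

  Conversely, for a matrix \<open>X\<close> let \<open>p(X)\<close> be the sum of all \<open>|tr(Z^m X)|\<^sup>2\<close>. Positivity of the Choi matrix
  says \<open>p(\<Lambda>X) \<le> p(X)\<close>. Since \<open>p\<close> vanishes at commutators \<open>ZY - YZ\<close>, \<open>\<Lambda>\<close> commutes with \<open>Z\<close>. Hence
  \<open>d(X) = p(X) - p(\<Lambda>X)\<close> satisfies \<open>d(X) + |tr(\<Lambda>X)|\<^sup>2 = d(ZX) + |tr X|\<^sup>2\<close>. Writing \<open>d(X) = |G X|\<^sup>2\<close>, the
  isometry \<open>(G(ZX), tr X) \<mapsto> (G X, tr(\<Lambda>X))\<close> extends to a linear contraction, whose transfer function \<open>f\<close>
  is bounded by 1 and satisfies \<open>tr(\<Lambda>X) = \<Sum>k. f\<^sub>k tr(Z^k X)\<close>, that is, \<open>\<Lambda> = f(Z)\<close>.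
\<close>

section \<open>The Lyapunov map\<close>

definition cinner :: "complex^'n \<Rightarrow> complex^'n \<Rightarrow> complex" where
  "cinner u v = (\<Sum>a\<in>UNIV. cnj (u $ a) * v $ a)"

text \<open>The index set is left open: \<open>{..<k}\<close> gives the form behind
  \<open>block_psd\<close>, while the Choi matrix is indexed by the finite type \<open>'n\<close>
  itself.\<close>

definition block_form :: "'i set \<Rightarrow> ('i \<Rightarrow> 'i \<Rightarrow> complex^'n^'n) \<Rightarrow> ('i \<Rightarrow> complex^'n) \<Rightarrow> complex" where
  "block_form I P x = (\<Sum>i\<in>I. \<Sum>j\<in>I. cinner (x i) (P i j *v x j))"

primrec mat_pow :: "'a::semiring_1^'n^'n \<Rightarrow> nat \<Rightarrow> 'a^'n^'n" where
  "mat_pow A 0 = mat 1"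
| "mat_pow A (Suc k) = A ** mat_pow A k"

lemma mat_pow_Suc_right: "mat_pow A (Suc k) = mat_pow A k ** A"
  by (induction k) (simp_all add: matrix_mul_assoc)

lemma mat_pow_add: "mat_pow A (m + k) = mat_pow A m ** mat_pow A k"
  by (induction m) (simp_all add: matrix_mul_assoc)

lemma mat_pow_commute: "A ** B = B ** A \<Longrightarrow> mat_pow A k ** B = B ** mat_pow A k"
proof (induction k)
  case (Suc k)
  have "mat_pow A (Suc k) ** B = A ** (mat_pow A k ** B)" by (simp add: matrix_mul_assoc)
  also have "\<dots> = B ** mat_pow A (Suc k)" by (simp add: Suc matrix_mul_assoc)
  finally show ?case .
qed simp

lemma cinner_diff_right: "cinner x (y - z) = cinner x y - cinner x z"
  by (simp add: cinner_def algebra_simps sum_subtractf)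

lemma cinner_sum_right: "cinner x (\<Sum>i\<in>I. y i) = (\<Sum>i\<in>I. cinner x (y i))"
  unfolding cinner_def sum_component sum_distrib_left by (rule sum.swap)

lemma cinner_cadjoint: "cinner x (cadjoint A *v y) = cinner (A *v x) y"
proof -
  have "cinner x (cadjoint A *v y) = (\<Sum>a\<in>UNIV. \<Sum>b\<in>UNIV. cnj (x $ a) * (cnj (A $ b $ a) * y $ b))"
    by (simp add: cinner_def cadjoint_def matrix_vector_mult_def transpose_def map_matrix_def sum_distrib_left)
  also have "\<dots> = (\<Sum>b\<in>UNIV. \<Sum>a\<in>UNIV. cnj (x $ a) * (cnj (A $ b $ a) * y $ b))"
    by (rule sum.swap)
  also have "\<dots> = cinner (A *v x) y"
    by (simp add: cinner_def matrix_vector_mult_def sum_distrib_left sum_distrib_right mult_ac)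
  finally show ?thesis .
qed

lemma cinner_lyapunov:
  "cinner x (lyapunov A H *v y) = cinner x (H *v y) - cinner (A *v x) (H *v (A *v y))"
  by (simp add: lyapunov_def matrix_vector_mult_diff_rdistrib cinner_diff_right cinner_cadjoint
      flip: matrix_vector_mul_assoc)

text \<open>Positivity of the blocks \<open>lyapunov A (P i j)\<close> thus says that the form of
  \<open>P\<close> does not increase when every \<open>x i\<close> is replaced by
  \<open>A *v x i\<close>. Both directions of the theorem use this with
  \<open>A = \<Lambda>\<close>.\<close>

lemma block_form_lyapunov:
  "block_form I (\<lambda>i j. lyapunov A (P i j)) x = block_form I P x - block_form I P (\<lambda>i. A *v x i)"
  by (simp add: block_form_def cinner_lyapunov sum_subtractf)

lemma block_psd_iff: "block_psd k M \<longleftrightarrow> (\<forall>x. block_form {..<k} M x \<in> \<real>\<^sub>\<ge>\<^sub>0)"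
proof -
  have "(\<Sum>i<k. \<Sum>a\<in>UNIV. cnj (x i $ a) * (\<Sum>j<k. M i j *v x j) $ a) = block_form {..<k} M x" for x
    unfolding block_form_def cinner_sum_right[symmetric] by (simp add: cinner_def)
  then show ?thesis by (simp add: block_psd_def)
qed

lemma cinner_axis: "cinner (axis i 1) (A *v axis j 1) = A $ i $ j"
proof -
  have "cinner (axis i 1) v = v $ i" for v
    by (simp add: cinner_def axis_def if_distrib[of cnj] if_distrib[of "\<lambda>x. x * _"] cong: if_cong)
  then show ?thesis by (simp add: matrix_vector_mult_def axis_def if_distrib[of "\<lambda>x. _ * x"] cong: if_cong)
qed

lemma bounded_linear_matrix_vector: "bounded_linear ((*v) (A :: complex^'n^'m))"
proof (rule linear_conv_bounded_linear[THEN iffD1], rule linearI)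
  show "A *v (r *\<^sub>R b) = r *\<^sub>R (A *v b)" for r b
    by (simp add: vec_eq_iff matrix_vector_mult_def scaleR_sum_right)
qed (simp add: matrix_vector_right_distrib)

lemma norm_mat_pow_le:
  fixes A :: "complex^'n^'n"
  shows "norm (mat_pow A k *v x) \<le> onorm ((*v) A) ^ k * norm x"
proof (induction k)
  case (Suc k)
  have "norm (mat_pow A (Suc k) *v x) \<le> onorm ((*v) A) * norm (mat_pow A k *v x)"
    using onorm[OF bounded_linear_matrix_vector] by (simp flip: matrix_vector_mul_assoc)
  also have "\<dots> \<le> onorm ((*v) A) * (onorm ((*v) A) ^ k * norm x)"
    by (intro mult_left_mono Suc onorm_pos_le bounded_linear_matrix_vector)
  finally show ?case by simp
qed simp

lemma mat_pow_tendsto_0: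
  fixes A :: "complex^'n^'n"
  assumes "strict_contraction A"
  shows "(\<lambda>k. mat_pow A k *v x) \<longlonglongrightarrow> 0"
proof (rule Lim_null_comparison)
  show "\<forall>\<^sub>F k in sequentially. norm (mat_pow A k *v x) \<le> onorm ((*v) A) ^ k * norm x"
    by (simp add: norm_mat_pow_le)
  show "(\<lambda>k. onorm ((*v) A) ^ k * norm x) \<longlonglongrightarrow> 0"
    using assms onorm_pos_le[OF bounded_linear_matrix_vector, of A]
    by (intro tendsto_mult_left_zero LIMSEQ_realpow_zero) (auto simp: strict_contraction_def)
qed

lemma tendsto_cinner [tendsto_intros]:
  "(f \<longlongrightarrow> a) F \<Longrightarrow> (g \<longlongrightarrow> b) F \<Longrightarrow> ((\<lambda>x. cinner (f x) (g x)) \<longlongrightarrow> cinner a b) F"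
  unfolding cinner_def by (intro tendsto_intros)

lemma tendsto_matrix_vector [tendsto_intros]:
  "(g \<longlongrightarrow> b) F \<Longrightarrow> ((\<lambda>x. (A :: complex^'n^'m) *v g x) \<longlongrightarrow> A *v b) F"
  by (rule bounded_linear.tendsto[OF bounded_linear_matrix_vector])

lemma tendsto_block_form [tendsto_intros]:
  "(\<And>i. i \<in> I \<Longrightarrow> ((\<lambda>n. x n i) \<longlongrightarrow> y i) F) \<Longrightarrow>
    ((\<lambda>n. block_form I P (x n)) \<longlongrightarrow> block_form I P y) F"
  unfolding block_form_def by (intro tendsto_intros)

lemma block_form_0 [simp]: "block_form I P (\<lambda>i. 0) = 0"
  by (simp add: block_form_def cinner_def)

text \<open>Each summand on the left is the drop of the form of \<open>P\<close> from one iterate of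
  \<open>Z\<close> to the next.\<close>

lemma block_form_telescope:
  assumes "\<And>i j. i \<in> I \<Longrightarrow> j \<in> I \<Longrightarrow> lyapunov Z (P i j) = H i j"
  shows "(\<Sum>m<N. block_form I H (\<lambda>i. mat_pow Z m *v x i)) =
    block_form I P x - block_form I P (\<lambda>i. mat_pow Z N *v x i)"
proof (induction N)
  case (Suc N)
  have "block_form I H (\<lambda>i. mat_pow Z N *v x i) =
      block_form I P (\<lambda>i. mat_pow Z N *v x i) - block_form I P (\<lambda>i. mat_pow Z (Suc N) *v x i)"
    using block_form_lyapunov[of I Z P "\<lambda>i. mat_pow Z N *v x i", symmetric]
    by (simp add: block_form_def assms matrix_vector_mul_assoc)
  with Suc show ?case by simp
qed simp

text \<open>The series for the inverse of \<open>lyapunov Z\<close>, read through quadratic forms: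
  the remainder of the telescoping sum vanishes because the powers of a strict contraction tend to
  0.\<close>

lemma block_form_sums:
  fixes Z :: "complex^'n^'n"
  assumes "strict_contraction Z"
    and "\<And>i j. i \<in> I \<Longrightarrow> j \<in> I \<Longrightarrow> lyapunov Z (P i j) = H i j"
  shows "(\<lambda>m. block_form I H (\<lambda>i. mat_pow Z m *v x i)) sums block_form I P x"
proof -
  have "(\<lambda>N. block_form I P x - block_form I P (\<lambda>i. mat_pow Z N *v x i)) \<longlonglongrightarrow>
      block_form I P x - block_form I P (\<lambda>i. 0)"
    by (intro tendsto_intros mat_pow_tendsto_0 assms)
  then show ?thesis
    unfolding sums_def by (subst block_form_telescope[where P = P and Z = Z, OF assms(2)]) simp_all
qed

section \<open>Invertibility of the Lyapunov map\<close>

lemma linear_lyapunov: "linear (lyapunov Z)"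
proof (rule linearI)
  show "lyapunov Z (r *\<^sub>R b) = r *\<^sub>R lyapunov Z b" for r b
    by (simp add: lyapunov_def vec_eq_iff matrix_matrix_mult_def scaleR_sum_right scaleR_diff_right
        sum_distrib_left sum_distrib_right)
qed (simp add: lyapunov_def matrix_add_ldistrib matrix_matrix_mult_def vec_eq_iff algebra_simps sum.distrib)

lemma cscale_matrix_mult:
  "cscale c A ** B = cscale c (A ** B)" "A ** cscale c B = cscale c (A ** B)"
  by (simp_all add: cscale_def map_matrix_def matrix_matrix_mult_def vec_eq_iff sum_distrib_left mult_ac)

lemma lyapunov_cscale: "lyapunov Z (cscale c H) = cscale c (lyapunov Z H)"
  unfolding lyapunov_def cscale_matrix_mult
  by (simp add: cscale_def map_matrix_def vec_eq_iff right_diff_distrib)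

text \<open>If \<open>lyapunov Z H = 0\<close>, the form of \<open>H\<close> is unchanged when
  \<open>Z\<close> is applied to both arguments, hence equals its limit 0 along the iterates.
  Injectivity suffices in finite dimension.\<close>

lemma bij_lyapunov:
  fixes Z :: "complex^'n^'n"
  assumes "strict_contraction Z"
  shows "bij (lyapunov Z)"
proof -
  have "inj (lyapunov Z)"
    unfolding linear_injective_0[OF linear_lyapunov]
  proof (intro allI impI)
    fix H assume H: "lyapunov Z H = 0"
    have "cinner x (H *v y) = 0" for x y
    proof -
      have "cinner x (H *v y) = cinner (mat_pow Z k *v x) (H *v (mat_pow Z k *v y))" for k
      proof (induction k)
        case (Suc k)
        have "cinner u (H *v v) = cinner (Z *v u) (H *v (Z *v v))" for u v
          using cinner_lyapunov[of u Z H v] by (simp add: H cinner_def)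
        then show ?case by (simp add: Suc flip: matrix_vector_mul_assoc)
      qed simp
      moreover have "(\<lambda>k. cinner (mat_pow Z k *v x) (H *v (mat_pow Z k *v y))) \<longlonglongrightarrow> cinner 0 (H *v 0)"
        by (intro tendsto_intros mat_pow_tendsto_0 assms)
      ultimately have "(\<lambda>k::nat. cinner x (H *v y)) \<longlonglongrightarrow> cinner 0 (H *v 0)" by simp
      then show ?thesis by (simp add: LIMSEQ_const_iff cinner_def)
    qed
    then show "H = 0"
      by (simp add: vec_eq_iff flip: cinner_axis)
  qed
  then show ?thesis
    unfolding bij_def using linear_injective_imp_surjective[OF linear_lyapunov] by blast
qed

lemma lyapunov_inv: "strict_contraction Z \<Longrightarrow> lyapunov Z (inv (lyapunov Z) H) = H"
  by (meson bij_inv_eq_iff bij_lyapunov)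

lemma vector_space_cscale: "vector_space (cscale :: complex \<Rightarrow> complex^'n^'m \<Rightarrow> _)"
  by unfold_locales (simp_all add: cscale_def map_matrix_def vec_eq_iff algebra_simps)

lemma linear_lyapunov_inv:
  fixes Z \<Lambda> :: "complex^'n^'n"
  assumes "strict_contraction Z"
  shows "Vector_Spaces.linear cscale cscale (lyapunov \<Lambda> \<circ> inv (lyapunov Z))"
proof -
  interpret vector_space "cscale :: complex \<Rightarrow> complex^'n^'n \<Rightarrow> _" by (rule vector_space_cscale)
  have inj: "inv (lyapunov Z) H = K \<longleftrightarrow> lyapunov Z K = H" for H K
    using bij_inv_eq_iff[OF bij_lyapunov[OF assms], of K H] by metis
  have "inv (lyapunov Z) (H + K) = inv (lyapunov Z) H + inv (lyapunov Z) K" for H K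
    unfolding inj linear_add[OF linear_lyapunov] by (simp add: lyapunov_inv assms)
  moreover have "inv (lyapunov Z) (cscale c H) = cscale c (inv (lyapunov Z) H)" for c H
    unfolding inj lyapunov_cscale by (simp add: lyapunov_inv assms)
  ultimately show ?thesis
    by unfold_locales (simp_all add: linear_add[OF linear_lyapunov] lyapunov_cscale)
qed

section \<open>Positive semidefinite kernels\<close>

definition kernel_form :: "'a set \<Rightarrow> ('a \<Rightarrow> 'a \<Rightarrow> complex) \<Rightarrow> ('a \<Rightarrow> complex) \<Rightarrow> ('a \<Rightarrow> complex) \<Rightarrow> complex" where
  "kernel_form S a x y = (\<Sum>p\<in>S. \<Sum>q\<in>S. cnj (x p) * a p q * y q)"

lemma kernel_form_add:
  "kernel_form S a (\<lambda>p. x p + x' p) y = kernel_form S a x y + kernel_form S a x' y"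
  "kernel_form S a x (\<lambda>p. y p + y' p) = kernel_form S a x y + kernel_form S a x y'"
  by (simp_all add: kernel_form_def algebra_simps sum.distrib)

lemma kernel_form_single:
  assumes "finite S" "b \<in> S"
  shows "kernel_form S a (\<lambda>p. if p = b then t else 0) y = cnj t * (\<Sum>q\<in>S. a b q * y q)"
    and "kernel_form S a x (\<lambda>p. if p = b then t else 0) = (\<Sum>p\<in>S. cnj (x p) * a p b) * t"
proof -
  have "kernel_form S a (\<lambda>p. if p = b then t else 0) y =
      (\<Sum>p\<in>S. if p = b then cnj t * (\<Sum>q\<in>S. a b q * y q) else 0)"
    unfolding kernel_form_def by (rule sum.cong) (auto simp: sum_distrib_left mult_ac)
  then show "kernel_form S a (\<lambda>p. if p = b then t else 0) y = cnj t * (\<Sum>q\<in>S. a b q * y q)"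
    using assms by simp
  have "kernel_form S a x (\<lambda>p. if p = b then t else 0) =
      (\<Sum>p\<in>S. \<Sum>q\<in>S. if q = b then cnj (x p) * a p b * t else 0)"
    unfolding kernel_form_def by (intro sum.cong) auto
  then show "kernel_form S a x (\<lambda>p. if p = b then t else 0) = (\<Sum>p\<in>S. cnj (x p) * a p b) * t"
    using assms by (simp add: sum_distrib_right)
qed

text \<open>The two point masses are added instead of chosen by cases, so that \<open>p = q\<close>
  is allowed; the diagonal entries are treated in this way below.\<close>

lemma kernel_form_pair:
  assumes "finite S" "p \<in> S" "q \<in> S"
  shows "kernel_form S a (\<lambda>r. (if r = p then s else 0) + (if r = q then t else 0))
      (\<lambda>r. (if r = p then s else 0) + (if r = q then t else 0)) =
    cnj s * a p p * s + cnj s * a p q * t + cnj t * a q p * s + cnj t * a q q * t"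
proof -
  have "(\<Sum>r\<in>S. a p' r * (if r = q' then u else 0)) = a p' q' * u" if "q' \<in> S" for p' q' u
    using that assms(1) by (simp add: if_distrib[of "\<lambda>z. _ * z"] cong: if_cong)
  then show ?thesis
    using assms by (simp add: kernel_form_add kernel_form_single mult_ac)
qed

context
  fixes S :: "'a set" and a :: "'a \<Rightarrow> 'a \<Rightarrow> complex"
  assumes fin: "finite S" and psd: "\<And>x. kernel_form S a x x \<in> \<real>\<^sub>\<ge>\<^sub>0"
begin

lemma kernel_form_pair_psd:
  assumes "p \<in> S" "q \<in> S"
  shows "cnj s * a p p * s + cnj s * a p q * t + cnj t * a q p * s + cnj t * a q q * t \<in> \<real>\<^sub>\<ge>\<^sub>0"
  unfolding kernel_form_pair[OF fin assms, symmetric] by (rule psd)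

lemma kernel_diag_psd: "p \<in> S \<Longrightarrow> a p p \<in> \<real>\<^sub>\<ge>\<^sub>0"
  using kernel_form_pair_psd[of p p 1 0] by simp

text \<open>The form is real at e_p + e_q, which matches the imaginary parts, and at e_p + \<i> e_q,
  which matches the real parts.\<close>

lemma kernel_hermitian:
  assumes "p \<in> S" "q \<in> S"
  shows "a q p = cnj (a p q)"
proof -
  have d: "Im (a r r) = 0" if "r \<in> S" for r
    using kernel_diag_psd[OF that] by (simp add: complex_nonneg_Reals_iff)
  show ?thesis
    using kernel_form_pair_psd[OF assms, of 1 1] kernel_form_pair_psd[OF assms, of 1 \<i>]
      d[OF assms(1)] d[OF assms(2)] by (simp add: complex_nonneg_Reals_iff complex_eq_iff)
qed

text \<open>With a zero diagonal entry at \<open>b\<close>, the form at e_q - s (a b q) e_b is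
  affine in the real number \<open>s\<close>, with slope -2 |a b q|^2. The \<open>s\<close> chosen
  below makes its real part -1.\<close>

lemma kernel_row_zero:
  assumes "b \<in> S" "q \<in> S" "a b b = 0"
  shows "a b q = 0"
proof (rule ccontr)
  assume ne: "a b q \<noteq> 0"
  define s where "s = (Re (a q q) + 1) / (2 * (cmod (a b q))\<^sup>2)"
  have "0 \<le> Re (a q q) - 2 * s * (cmod (a b q))\<^sup>2"
    using kernel_form_pair_psd[OF assms(1,2), of "- of_real s * a b q" 1] assms kernel_hermitian[OF assms(1,2)]
    unfolding cmod_power2 by (simp add: complex_nonneg_Reals_iff power2_eq_square algebra_simps)
  moreover have "2 * s * (cmod (a b q))\<^sup>2 = Re (a q q) + 1"
    using ne by (simp add: s_def field_simps)
  ultimately show False by simp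
qed

end

text \<open>Cholesky factorization by symmetric elimination. The induction runs over a set
  \<open>T\<close> such that all rows outside \<open>T\<close> vanish; a pivot \<open>b\<close>
  leaves \<open>T\<close> either because its row is zero already or after subtracting a kernel of
  rank one.\<close>

theorem psd_kernel_gram:
  fixes a :: "'a \<Rightarrow> 'a \<Rightarrow> complex"
  assumes "finite S" "\<And>x. kernel_form S a x x \<in> \<real>\<^sub>\<ge>\<^sub>0"
  shows "\<exists>g. \<forall>p\<in>S. \<forall>q\<in>S. a p q = (\<Sum>r\<in>S. cnj (g r p) * g r q)"
proof -
  have "\<exists>g. \<forall>p\<in>S. \<forall>q\<in>S. a p q = (\<Sum>r\<in>T. cnj (g r p) * g r q)"
    if "finite T" "T \<subseteq> S" "\<And>x. kernel_form S a x x \<in> \<real>\<^sub>\<ge>\<^sub>0"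
      "\<And>p q. p \<in> S - T \<Longrightarrow> q \<in> S \<Longrightarrow> a p q = 0" for T and a :: "'a \<Rightarrow> 'a \<Rightarrow> complex"
    using that
  proof (induction T arbitrary: a rule: finite_induct)
    case empty
    then show ?case by auto
  next
    case (insert b T)
    note psd = insert.prems(2)
    have bS: "b \<in> S" using insert.prems by auto
    have herm: "a q p = cnj (a p q)" if "p \<in> S" "q \<in> S" for p q
      by (rule kernel_hermitian[OF assms(1) psd that])
    have abb: "a b b = complex_of_real (Re (a b b))"
      using herm[OF bS bS] by (simp add: complex_eq_iff)
    show ?case
    proof (cases "a b b = 0")
      case True
      have "\<exists>g. \<forall>p\<in>S. \<forall>q\<in>S. a p q = (\<Sum>r\<in>T. cnj (g r p) * g r q)"
      proof (rule insert.IH)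
        show "a p q = 0" if "p \<in> S - T" "q \<in> S" for p q
          using kernel_row_zero[OF assms(1) psd bS _ True] insert.prems(3) that by (cases "p = b") auto
      qed (use insert.prems in auto)
      then obtain g where g: "\<forall>p\<in>S. \<forall>q\<in>S. a p q = (\<Sum>r\<in>T. cnj (g r p) * g r q)" by blast
      have "(\<Sum>r\<in>insert b T. cnj ((g(b := \<lambda>_. 0)) r p) * (g(b := \<lambda>_. 0)) r q) =
          (\<Sum>r\<in>T. cnj (g r p) * g r q)" for p q
        using insert.hyps by (auto intro!: sum.cong)
      with g show ?thesis by (intro exI[of _ "g(b := \<lambda>_. 0)"]) simp
    next
      case False
      define d where "d = Re (a b b)"
      have "d \<ge> 0"
        using kernel_diag_psd[OF assms(1) psd bS] by (simp add: d_def complex_nonneg_Reals_iff)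
      with False abb have d: "d > 0" "a b b = of_real d"
        by (auto simp: d_def less_le)
      define a' where "a' = (\<lambda>p q. a p q - a p b * a b q / of_real d)"
      have "\<exists>g. \<forall>p\<in>S. \<forall>q\<in>S. a' p q = (\<Sum>r\<in>T. cnj (g r p) * g r q)"
      proof (rule insert.IH)
        show "kernel_form S a' x x \<in> \<real>\<^sub>\<ge>\<^sub>0" for x
        proof -
          define u where "u = (\<Sum>q\<in>S. a b q * x q)"
          have cu: "(\<Sum>p\<in>S. cnj (x p) * a p b) = cnj u"
            unfolding u_def cnj_sum by (intro sum.cong) (simp_all add: herm[OF bS] mult.commute)
          \<comment> \<open>Completing the square: shifting the coordinate \<open>b\<close> by
            \<open>- u / d\<close> turns the form of \<open>a\<close> into the form of
            \<open>a'\<close> at the unshifted \<open>x\<close>, so \<open>a'\<close> inherits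
            positivity.\<close>
          define y where "y = (\<lambda>p. if p = b then - u / of_real d else 0)"
          have yb: "(\<Sum>q\<in>S. a b q * y q) = - u"
            using assms(1) bS d by (simp add: y_def if_distrib[of "\<lambda>z. _ * z"] cong: if_cong)
          have "kernel_form S a (\<lambda>p. x p + y p) (\<lambda>p. x p + y p) = kernel_form S a x x - cnj u * u / of_real d"
            unfolding kernel_form_add
            using kernel_form_single(1)[OF assms(1) bS, of a "- u / of_real d" x]
              kernel_form_single(1)[OF assms(1) bS, of a "- u / of_real d" y]
              kernel_form_single(2)[OF assms(1) bS, of a x "- u / of_real d"]
            unfolding y_def[symmetric] cu yb u_def[symmetric] by (simp add: field_simps)
          also have "cnj u * u / of_real d = (\<Sum>p\<in>S. \<Sum>q\<in>S. cnj (x p) * a p b * (a b q * x q) / of_real d)"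
            unfolding cu[symmetric] unfolding u_def sum_product sum_divide_distrib ..
          also have "kernel_form S a x x - \<dots> = kernel_form S a' x x"
            by (simp add: kernel_form_def a'_def algebra_simps sum_subtractf)
          finally show ?thesis using psd by metis
        qed
        show "a' p q = 0" if "p \<in> S - T" "q \<in> S" for p q
        proof (cases "p = b")
          case True
          then show ?thesis using d by (simp add: a'_def)
        next
          case False
          then have "a p q = 0" "a p b = 0" using that insert.prems(3) bS by auto
          then show ?thesis by (simp add: a'_def)
        qed
      qed (use insert.prems in auto)
      then obtain g where g: "\<forall>p\<in>S. \<forall>q\<in>S. a' p q = (\<Sum>r\<in>T. cnj (g r p) * g r q)" by blast
      \<comment> \<open>The new row is the pivot row over the square root of \<open>d\<close>; its
        rank one kernel is exactly what was subtracted from \<open>a\<close>.\<close>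
      define g' where "g' = g(b := \<lambda>q. a b q / of_real (sqrt d))"
      have "a p q = (\<Sum>r\<in>insert b T. cnj (g' r p) * g' r q)" if "p \<in> S" "q \<in> S" for p q
      proof -
        have "(\<Sum>r\<in>insert b T. cnj (g' r p) * g' r q) =
            cnj (a b p) * a b q / (of_real (sqrt d) * of_real (sqrt d)) + (\<Sum>r\<in>T. cnj (g r p) * g r q)"
          using insert.hyps by (auto simp: g'_def intro!: sum.cong)
        also have "of_real (sqrt d) * of_real (sqrt d) = complex_of_real d"
          using d by (simp flip: of_real_mult)
        also have "cnj (a b p) = a p b" using herm[OF bS that(1)] by simp
        finally show ?thesis using g[rule_format, OF that] by (simp add: a'_def algebra_simps)
      qed
      then show ?thesis by blast
    qed
  qed
  from this[of S a] assms show ?thesis by auto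
qed

lemma kernel_form_gram:
  assumes "\<forall>p\<in>S. \<forall>q\<in>S. a p q = (\<Sum>r\<in>T. cnj (g r p) * g r q)"
  shows "kernel_form S a x x = of_real (\<Sum>r\<in>T. (cmod (\<Sum>q\<in>S. g r q * x q))\<^sup>2)"
proof -
  have "kernel_form S a x x = (\<Sum>p\<in>S. \<Sum>q\<in>S. \<Sum>r\<in>T. (g r q * x q) * cnj (g r p * x p))"
    unfolding kernel_form_def using assms
    by (intro sum.cong) (auto simp: sum_distrib_left sum_distrib_right mult_ac)
  also have "\<dots> = (\<Sum>r\<in>T. \<Sum>p\<in>S. \<Sum>q\<in>S. (g r q * x q) * cnj (g r p * x p))"
    by (subst (2) sum.swap, subst sum.swap) (rule refl)
  also have "\<dots> = (\<Sum>r\<in>T. (\<Sum>q\<in>S. g r q * x q) * cnj (\<Sum>p\<in>S. g r p * x p))"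
    unfolding cnj_sum sum_product by (intro sum.cong refl sum.swap)
  finally show ?thesis
    by (simp add: complex_norm_square del: of_real_power)
qed

section \<open>Block matrices as scalar kernels\<close>

lemma block_form_eq_kernel_form:
  fixes M :: "'a \<Rightarrow> 'a \<Rightarrow> complex^('b::finite)^'b"
  shows
  "block_form I M x = kernel_form (I \<times> UNIV) (\<lambda>(i, s) (j, t). M i j $ s $ t) (\<lambda>(i, s). x i $ s) (\<lambda>(i, s). x i $ s)"
proof -
  have "block_form I M x =
      (\<Sum>i\<in>I. \<Sum>j\<in>I. \<Sum>s\<in>UNIV. \<Sum>t\<in>UNIV. cnj (x i $ s) * M i j $ s $ t * x j $ t)"
    by (simp add: block_form_def cinner_def matrix_vector_mult_def sum_distrib_left mult_ac)
  also have "\<dots> = (\<Sum>i\<in>I. \<Sum>s\<in>UNIV. \<Sum>j\<in>I. \<Sum>t\<in>UNIV. cnj (x i $ s) * M i j $ s $ t * x j $ t)"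
    by (intro sum.cong refl sum.swap)
  finally have "block_form I M x =
      (\<Sum>i\<in>I. \<Sum>s\<in>UNIV. \<Sum>j\<in>I. \<Sum>t\<in>UNIV. cnj (x i $ s) * M i j $ s $ t * x j $ t)" .
  moreover have "sum F (I \<times> UNIV) = (\<Sum>i\<in>I. \<Sum>s\<in>UNIV. F (i, s))" for F :: "'a \<times> 'b \<Rightarrow> complex"
    by (simp add: sum.cartesian_product)
  ultimately show ?thesis
    by (simp add: kernel_form_def)
qed

text \<open>Used twice: the functionals in the squares produce the scalar sequences on which the
  Toeplitz contraction acts, and in the converse direction they are the components of the map
  \<open>G\<close>.\<close>

lemma block_form_gram:
  fixes M :: "'i \<Rightarrow> 'i \<Rightarrow> complex^('n::finite)^'n"
  assumes "finite I" "\<And>x. block_form I M x \<in> \<real>\<^sub>\<ge>\<^sub>0"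
  obtains g :: "'i \<times> 'n \<Rightarrow> 'i \<times> 'n \<Rightarrow> complex"
  where "\<And>x :: 'i \<Rightarrow> complex^'n.
    block_form I M x = of_real (\<Sum>r\<in>I \<times> UNIV. (cmod (\<Sum>(i, s)\<in>I \<times> UNIV. g r (i, s) * x i $ s))\<^sup>2)"
proof -
  let ?a = "\<lambda>(i, s) (j, t). M i j $ s $ t"
  have psd: "kernel_form (I \<times> UNIV) ?a X X \<in> \<real>\<^sub>\<ge>\<^sub>0" for X
    using assms(2)[of "\<lambda>i. \<chi> s. X (i, s)"] by (simp add: block_form_eq_kernel_form)
  have fin: "finite (I \<times> (UNIV :: 'n set))" using assms(1) by simp
  from psd_kernel_gram[OF fin psd] obtain g :: "'i \<times> 'n \<Rightarrow> 'i \<times> 'n \<Rightarrow> complex"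
    where "\<forall>p\<in>I \<times> UNIV. \<forall>q\<in>I \<times> UNIV. ?a p q = (\<Sum>r\<in>I \<times> UNIV. cnj (g r p) * g r q)"
    by blast
  from kernel_form_gram[OF this] show ?thesis
    by (intro that[of g]) (simp add: block_form_eq_kernel_form case_prod_unfold)
qed

section \<open>Toeplitz contractions\<close>

text \<open>Because \<open>w s ^ k = w k ^ s\<close>, the sum over \<open>s\<close> is geometric;
  its ratio is an \<open>M\<close>-th root of unity, equal to 1 only for
  \<open>k = l\<close>.\<close>

lemma sum_roots_of_unity_orthogonal:
  assumes "k < M" "l < M"
  defines "w \<equiv> \<lambda>s. cis (2 * pi * real s / real M)"
  shows "(\<Sum>s<M. w s ^ k * cnj (w s ^ l)) = (if k = l then of_nat M else 0)"
proof -
  have sw: "w s ^ k = w k ^ s" for s k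
    unfolding w_def Complex.DeMoivre by (rule arg_cong[of _ _ cis]) simp
  have eq: "w s ^ k * cnj (w s ^ l) = (w k * cnj (w l)) ^ s" for s
    using sw[of s k] sw[of s l] by (simp add: power_mult_distrib)
  have un: "w k * cnj (w k) = 1" for k
    by (simp add: w_def cis_cnj cis_mult)
  show ?thesis
  proof (cases "k = l")
    case True
    then show ?thesis unfolding eq by (simp add: un)
  next
    case False
    have "w k \<noteq> w l"
      using Complex.bij_betw_roots_unity[of M] assms(1,2) False
      by (auto simp: w_def bij_betw_def inj_on_def)
    then have ne: "w k * cnj (w l) \<noteq> 1"
      using un[of l] by (metis mult.assoc mult.commute mult.right_neutral)
    have M: "w k ^ M = 1" for k
      using assms(1) by (simp add: w_def Complex.DeMoivre cis_multiple_2pi)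
    have "(w k * cnj (w l)) ^ M = 1"
      by (simp add: power_mult_distrib M flip: complex_cnj_power)
    with geometric_sum[OF ne, of M] False show ?thesis
      unfolding eq by simp
  qed
qed

text \<open>Sampling at \<open>M\<close> roots of unity is exact for degree below \<open>M\<close>,
  so finite sums take the place of integrals over the circle.\<close>

lemma poly_parseval:
  fixes p :: "complex poly"
  assumes "degree p < M"
  shows "(\<Sum>s<M. (cmod (poly p (cis (2 * pi * real s / real M))))\<^sup>2) = M * (\<Sum>k<M. (cmod (coeff p k))\<^sup>2)"
proof -
  define w where "w = (\<lambda>s. cis (2 * pi * real s / real M))"
  have p: "poly p z = (\<Sum>k<M. coeff p k * z ^ k)" for z
    unfolding poly_altdef using assms
    by (intro sum.mono_neutral_left) (auto simp: coeff_eq_0)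
  have "(\<Sum>s<M. poly p (w s) * cnj (poly p (w s))) =
      (\<Sum>s<M. \<Sum>k<M. \<Sum>l<M. coeff p k * cnj (coeff p l) * (w s ^ k * cnj (w s ^ l)))"
    unfolding p cnj_sum sum_product by (simp add: mult_ac)
  also have "\<dots> = (\<Sum>k<M. \<Sum>l<M. \<Sum>s<M. coeff p k * cnj (coeff p l) * (w s ^ k * cnj (w s ^ l)))"
    by (subst sum.swap, subst (2) sum.swap) (rule refl)
  also have "\<dots> = (\<Sum>k<M. \<Sum>l<M. if l = k then coeff p k * cnj (coeff p k) * of_nat M else 0)"
    unfolding sum_distrib_left[symmetric] w_def
    by (intro sum.cong, simp_all only: lessThan_iff sum_roots_of_unity_orthogonal) simp
  also have "\<dots> = of_nat M * (\<Sum>k<M. coeff p k * cnj (coeff p k))"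
    by (simp add: sum_distrib_left mult_ac)
  finally have "complex_of_real (\<Sum>s<M. (cmod (poly p (w s)))\<^sup>2) =
      complex_of_real (M * (\<Sum>k<M. (cmod (coeff p k))\<^sup>2))"
    by (simp add: complex_norm_square del: of_real_power)
  then show ?thesis unfolding of_real_eq_iff w_def .
qed

text \<open>With the entries of \<open>y\<close> in reverse order as the coefficients of a
  polynomial \<open>q\<close>, the sums on the left are the first \<open>N\<close> coefficients of
  \<open>p * q\<close>. Multiplication by \<open>p\<close> costs at most a factor \<open>B\<close>
  at each root of unity, and Parseval carries this bound to the coefficients.\<close>

lemma toeplitz_bound_poly:
  fixes p :: "complex poly"
  assumes "\<And>z. cmod z = 1 \<Longrightarrow> cmod (poly p z) \<le> B"
  shows "(\<Sum>m<N. (cmod (\<Sum>j<N - m. coeff p j * y (m + j)))\<^sup>2) \<le> B\<^sup>2 * (\<Sum>k<N. (cmod (y k))\<^sup>2)"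
proof (cases "N = 0")
  case False
  define q where "q = (\<Sum>k<N. monom (y (N - Suc k)) k)"
  have cq: "coeff q k = (if k < N then y (N - Suc k) else 0)" for k
    by (simp add: q_def coeff_sum)
  have dq: "degree q < N"
    using False by (intro degree_lessI) (auto simp: cq)
  \<comment> \<open>Enough sample points for Parseval to apply to both \<open>p * q\<close> and
    \<open>q\<close>.\<close>
  define M where "M = degree p + N"
  have M: "M > 0" "N \<le> M" using False by (auto simp: M_def)
  have dpq: "degree (p * q) < M"
    using degree_mult_le[of p q] dq by (simp add: M_def)
  have "(\<Sum>m<N. (cmod (\<Sum>j<N - m. coeff p j * y (m + j)))\<^sup>2) = (\<Sum>k<N. (cmod (coeff (p * q) k))\<^sup>2)"
  \<comment> \<open>The outer sum is reversed as well: coefficient \<open>k\<close> of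
    \<open>p * q\<close> belongs to the entry \<open>m = N - Suc k\<close>.\<close>
  proof (rule trans[OF sum.nat_diff_reindex[symmetric]], rule sum.cong)
    fix k assume "k \<in> {..<N}"
    then have k: "k < N" by simp
    have "(\<Sum>j<N - (N - Suc k). coeff p j * y (N - Suc k + j)) = (\<Sum>j\<le>k. coeff p j * coeff q (k - j))"
    proof (rule sum.cong)
      show "{..<N - (N - Suc k)} = {..k}" using k by auto
    next
      fix j assume "j \<in> {..k}"
      then have "N - Suc k + j = N - Suc (k - j)" "k - j < N" using k by auto
      then show "coeff p j * y (N - Suc k + j) = coeff p j * coeff q (k - j)" by (simp add: cq)
    qed
    then show "(cmod (\<Sum>j<N - (N - Suc k). coeff p j * y (N - Suc k + j)))\<^sup>2 = (cmod (coeff (p * q) k))\<^sup>2"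
      by (simp add: coeff_mult)
  qed simp
  also have "\<dots> \<le> (\<Sum>k<M. (cmod (coeff (p * q) k))\<^sup>2)"
    using M by (intro sum_mono2) auto
  finally have "M * (\<Sum>m<N. (cmod (\<Sum>j<N - m. coeff p j * y (m + j)))\<^sup>2) \<le>
      (\<Sum>s<M. (cmod (poly (p * q) (cis (2 * pi * real s / real M))))\<^sup>2)"
    unfolding poly_parseval[OF dpq] by (simp add: mult_left_mono)
  also have "\<dots> \<le> (\<Sum>s<M. B\<^sup>2 * (cmod (poly q (cis (2 * pi * real s / real M))))\<^sup>2)"
    by (intro sum_mono) (auto simp: norm_mult power_mult_distrib intro!: mult_right_mono power_mono assms)
  also have "\<dots> = M * (B\<^sup>2 * (\<Sum>k<M. (cmod (coeff q k))\<^sup>2))"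
    using dq M by (simp add: poly_parseval flip: sum_distrib_left)
  also have "(\<Sum>k<M. (cmod (coeff q k))\<^sup>2) = (\<Sum>k<N. (cmod (coeff q k))\<^sup>2)"
    using M by (intro sum.mono_neutral_right) (auto simp: cq)
  also have "\<dots> = (\<Sum>k<N. (cmod (y k))\<^sup>2)"
    by (subst (2) sum.nat_diff_reindex[symmetric]) (simp add: cq)
  finally show ?thesis using M by simp
qed simp

text \<open>The partial sums of \<open>f\<close> need not be bounded by 1, and \<open>f\<close> need
  not extend to the circle. Dilating to f(r z) first makes the series converge uniformly there, so a
  long partial sum is bounded by \<open>1 + e\<close>; then \<open>r\<close> tends to 1 and
  \<open>e\<close> to 0.\<close>

lemma toeplitz_bound_section:
  assumes f: "\<And>z. cmod z < 1 \<Longrightarrow> (\<lambda>k. c k * z ^ k) sums f z"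
    and bd: "\<And>z. cmod z < 1 \<Longrightarrow> cmod (f z) \<le> 1"
  shows "(\<Sum>m<N. (cmod (\<Sum>j<N - m. c j * y (m + j)))\<^sup>2) \<le> (\<Sum>k<N. (cmod (y k))\<^sup>2)"
proof -
  have *: "(\<Sum>m<N. (cmod (\<Sum>j<N - m. c j * of_real r ^ j * y (m + j)))\<^sup>2) \<le> (1 + e)\<^sup>2 * (\<Sum>k<N. (cmod (y k))\<^sup>2)"
    if r: "0 < r" "r < 1" and e: "e > 0" for r e :: real
  proof -
    \<comment> \<open>Convergence at a point strictly between \<open>r\<close> and 1 gives absolute
      convergence at \<open>r\<close>.\<close>
    have "summable (\<lambda>k. c k * of_real ((1 + r) / 2) ^ k)"
      using f[of "of_real ((1 + r) / 2)"] r by (intro sums_summable) (auto simp del: of_real_divide of_real_add)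
    then have sm: "summable (\<lambda>k. norm (c k * of_real r ^ k))"
      by (rule powser_insidea) (use r in \<open>auto simp del: of_real_divide of_real_add\<close>)
    obtain J where J: "\<And>n. n \<ge> J \<Longrightarrow> norm (\<Sum>i. norm (c (i + n) * of_real r ^ (i + n))) < e"
      using suminf_exist_split[OF e sm] by blast
    \<comment> \<open>Beyond \<open>J\<close> the tail is below \<open>e\<close>; at least
      \<open>N\<close> terms are kept so that the truncation retains every coefficient of the
      section.\<close>
    define n where "n = max J N"
    define p where "p = (\<Sum>k<n. monom (c k * of_real r ^ k) k)"
    have "cmod (poly p z) \<le> 1 + e" if z: "cmod z = 1" for z
    proof -
      have rz: "cmod (of_real r * z) < 1" using r z by (simp add: norm_mult)
      have t: "norm (c k * (of_real r * z) ^ k) = norm (c k * of_real r ^ k)" for k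
        by (simp add: norm_mult norm_power z)
      have "summable (\<lambda>i. norm (c (i + n) * (of_real r * z) ^ (i + n)))"
        unfolding t using summable_ignore_initial_segment[OF sm, of n] .
      from summable_norm[OF this] have "norm (\<Sum>i. c (i + n) * (of_real r * z) ^ (i + n)) \<le> e"
        unfolding t using J[of n] by (simp add: n_def)
      moreover have "f (of_real r * z) = (\<Sum>i. c (i + n) * (of_real r * z) ^ (i + n)) + (\<Sum>k<n. c k * (of_real r * z) ^ k)"
        using suminf_split_initial_segment[OF sums_summable[OF f[OF rz]]] sums_unique[OF f[OF rz]] by metis
      moreover have "poly p z = (\<Sum>k<n. c k * (of_real r * z) ^ k)"
        by (simp add: p_def poly_sum poly_monom power_mult_distrib mult_ac)
      ultimately show ?thesis
        using bd[OF rz] norm_triangle_ineq4[of "f (of_real r * z)" "\<Sum>i. c (i + n) * (of_real r * z) ^ (i + n)"]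
        by simp
    qed
    from toeplitz_bound_poly[of p "1 + e" y N, OF this]
    have "(\<Sum>m<N. (cmod (\<Sum>j<N - m. coeff p j * y (m + j)))\<^sup>2) \<le> (1 + e)\<^sup>2 * (\<Sum>k<N. (cmod (y k))\<^sup>2)" .
    moreover have "coeff p j = c j * of_real r ^ j" if "j < N" for j
      using that by (simp add: p_def coeff_sum n_def)
    ultimately show ?thesis by simp
  qed
  \<comment> \<open>The offset 2 keeps the radius positive already at \<open>n = 0\<close>.\<close>
  define r where "r = (\<lambda>n. 1 - 1 / real (n + 2))"
  define e where "e = (\<lambda>n. 1 / real (n + 1))"
  have r: "r \<longlonglongrightarrow> 1" unfolding r_def by real_asymp
  have e: "e \<longlonglongrightarrow> 0" unfolding e_def by real_asymp
  have "(\<lambda>n. \<Sum>m<N. (cmod (\<Sum>j<N - m. c j * of_real (r n) ^ j * y (m + j)))\<^sup>2) \<longlonglongrightarrow>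
      (\<Sum>m<N. (cmod (\<Sum>j<N - m. c j * of_real 1 ^ j * y (m + j)))\<^sup>2)"
    by (intro tendsto_intros r)
  moreover have "(\<lambda>n. (1 + e n)\<^sup>2 * (\<Sum>k<N. (cmod (y k))\<^sup>2)) \<longlonglongrightarrow> (1 + 0)\<^sup>2 * (\<Sum>k<N. (cmod (y k))\<^sup>2)"
    by (intro tendsto_intros e)
  moreover have "(\<Sum>m<N. (cmod (\<Sum>j<N - m. c j * of_real (r n) ^ j * y (m + j)))\<^sup>2) \<le>
      (1 + e n)\<^sup>2 * (\<Sum>k<N. (cmod (y k))\<^sup>2)" for n
    by (rule *) (simp_all add: r_def e_def)
  ultimately have "(\<Sum>m<N. (cmod (\<Sum>j<N - m. c j * of_real 1 ^ j * y (m + j)))\<^sup>2) \<le>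
      (1 + 0)\<^sup>2 * (\<Sum>k<N. (cmod (y k))\<^sup>2)"
    by (intro LIMSEQ_le) auto
  then show ?thesis by simp
qed

text \<open>Only \<open>M\<close> outputs are kept while the section length \<open>N\<close> tends
  to infinity, so that the limit can be taken output by output.\<close>

lemma toeplitz_bound:
  assumes "\<And>z. cmod z < 1 \<Longrightarrow> (\<lambda>k. c k * z ^ k) sums f z"
    and "\<And>z. cmod z < 1 \<Longrightarrow> cmod (f z) \<le> 1"
    and v: "\<And>m. (\<lambda>j. c j * y (m + j)) sums v m"
    and y: "(\<lambda>k. (cmod (y k))\<^sup>2) sums E"
  shows "(\<Sum>m<M. (cmod (v m))\<^sup>2) \<le> E"
proof (rule LIMSEQ_le)
  show "(\<lambda>N. \<Sum>m<M. (cmod (\<Sum>j<N - m. c j * y (m + j)))\<^sup>2) \<longlonglongrightarrow> (\<Sum>m<M. (cmod (v m))\<^sup>2)"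
  proof (intro tendsto_sum tendsto_power tendsto_norm)
    fix m
    show "(\<lambda>N. \<Sum>j<N - m. c j * y (m + j)) \<longlonglongrightarrow> v m"
      by (rule LIMSEQ_offset[of _ m]) (use v[of m] in \<open>simp add: sums_def\<close>)
  qed
  show "(\<lambda>N. \<Sum>k<N. (cmod (y k))\<^sup>2) \<longlonglongrightarrow> E"
    using y by (simp add: sums_def)
  show "\<exists>N0. \<forall>N\<ge>N0. (\<Sum>m<M. (cmod (\<Sum>j<N - m. c j * y (m + j)))\<^sup>2) \<le> (\<Sum>k<N. (cmod (y k))\<^sup>2)"
  proof (intro exI allI impI)
    fix N assume "M \<le> N"
    then have "(\<Sum>m<M. (cmod (\<Sum>j<N - m. c j * y (m + j)))\<^sup>2) \<le> (\<Sum>m<N. (cmod (\<Sum>j<N - m. c j * y (m + j)))\<^sup>2)"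
      by (intro sum_mono2) auto
    also have "\<dots> \<le> (\<Sum>k<N. (cmod (y k))\<^sup>2)"
      by (rule toeplitz_bound_section) fact+
    finally show "(\<Sum>m<M. (cmod (\<Sum>j<N - m. c j * y (m + j)))\<^sup>2) \<le> (\<Sum>k<N. (cmod (y k))\<^sup>2)" .
  qed
qed

text \<open>As \<open>\<Lambda>\<close> is a power series in \<open>Z\<close>, replacing
  \<open>x\<close> by \<open>\<Lambda> *v x\<close> acts on the orbit of \<open>x\<close> under
  \<open>Z\<close> through the coefficients \<open>c\<close>, by sums of the kind bounded in
  \<open>toeplitz_bound\<close>.\<close>

lemma power_series_matrix_vector_sums:
  assumes "\<And>i j. (\<lambda>k. c k * mat_pow Z k $ i $ j) sums (\<Lambda> $ i $ j :: complex)"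
  shows "(\<lambda>k. c k * (mat_pow Z (m + k) *v x) $ s) sums ((mat_pow Z m *v (\<Lambda> *v x)) $ s)"
proof -
  have "(\<lambda>k. c k * (mat_pow Z k *v x) $ t) sums ((\<Lambda> *v x) $ t)" for t
  proof -
    have "(\<lambda>k. \<Sum>u\<in>UNIV. c k * mat_pow Z k $ t $ u * x $ u) sums (\<Sum>u\<in>UNIV. \<Lambda> $ t $ u * x $ u)"
      by (intro sums_sum sums_mult2 assms)
    then show ?thesis by (simp add: matrix_vector_mult_def sum_distrib_left mult_ac)
  qed
  then have "(\<lambda>k. \<Sum>t\<in>UNIV. mat_pow Z m $ s $ t * (c k * (mat_pow Z k *v x) $ t)) sums
      (\<Sum>t\<in>UNIV. mat_pow Z m $ s $ t * (\<Lambda> *v x) $ t)"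
    by (intro sums_sum sums_mult)
  moreover have "(\<Sum>t\<in>UNIV. mat_pow Z m $ s $ t * (c k * (mat_pow Z k *v x) $ t)) = c k * (mat_pow Z (m + k) *v x) $ s" for k
    unfolding mat_pow_add matrix_vector_mul_assoc[symmetric]
    by (simp add: matrix_vector_mult_def[of "mat_pow Z m"] sum_distrib_left mult_ac)
  ultimately show ?thesis
    by (simp add: matrix_vector_mult_def[of "mat_pow Z m"])
qed

theorem schur_power_series_completely_positive:
  fixes Z \<Lambda> :: "complex^'n^'n"
  assumes Z: "strict_contraction Z"
    and f: "\<And>z. cmod z < 1 \<Longrightarrow> (\<lambda>k. c k * z ^ k) sums f z" "\<And>z. cmod z < 1 \<Longrightarrow> cmod (f z) \<le> 1"
    and \<Lambda>: "\<And>i j. (\<lambda>k. c k * mat_pow Z k $ i $ j) sums (\<Lambda> $ i $ j)"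
  shows "completely_positive (lyapunov \<Lambda> \<circ> inv (lyapunov Z))"
  unfolding completely_positive_def
proof (intro conjI allI impI)
  show "Vector_Spaces.linear cscale cscale (lyapunov \<Lambda> \<circ> inv (lyapunov Z))"
    by (rule linear_lyapunov_inv[OF Z])
next
  fix k and M :: "nat \<Rightarrow> nat \<Rightarrow> complex^'n^'n"
  assume "block_psd k M"
  then have "block_form {..<k} M x \<in> \<real>\<^sub>\<ge>\<^sub>0" for x by (simp add: block_psd_iff)
  from block_form_gram[OF finite_lessThan this] obtain g :: "nat \<times> 'n \<Rightarrow> nat \<times> 'n \<Rightarrow> complex"
    where g: "\<And>x. block_form {..<k} M x =
      of_real (\<Sum>r\<in>{..<k} \<times> UNIV. (cmod (\<Sum>(i, s)\<in>{..<k} \<times> UNIV. g r (i, s) * x i $ s))\<^sup>2)"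
    by blast
  define S where "S = {..<k} \<times> (UNIV :: 'n set)"
  define L where "L = (\<lambda>r x. \<Sum>(i, s)\<in>S. g r (i, s) * (x i :: complex^'n) $ s)"
  have fin: "finite S" by (simp add: S_def)
  have gL: "block_form {..<k} M x = of_real (\<Sum>r\<in>S. (cmod (L r x))\<^sup>2)" for x
    unfolding g S_def L_def ..
  define P where "P = (\<lambda>i j. inv (lyapunov Z) (M i j))"
  have P: "lyapunov Z (P i j) = M i j" for i j
    by (simp add: P_def lyapunov_inv Z)
  have "block_form {..<k} (\<lambda>i j. lyapunov \<Lambda> (P i j)) x \<in> \<real>\<^sub>\<ge>\<^sub>0" for x
  proof -
    \<comment> \<open>One pair of scalar sequences per functional \<open>L r\<close>: the Toeplitz
      operator takes \<open>y r\<close> to \<open>v r\<close>, and the forms of \<open>P\<close> at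
      \<open>x\<close> and at its image under \<open>\<Lambda>\<close> are the total energies of the
      two families.\<close>
    define y where "y = (\<lambda>r m. L r (\<lambda>i. mat_pow Z m *v x i))"
    define v where "v = (\<lambda>r m. L r (\<lambda>i. mat_pow Z m *v (\<Lambda> *v x i)))"
    define B1 where "B1 = block_form {..<k} P x"
    define B2 where "B2 = block_form {..<k} P (\<lambda>i. \<Lambda> *v x i)"
    have s: "(\<lambda>m. of_real (\<Sum>r\<in>S. (cmod (y r m))\<^sup>2)) sums B1" "(\<lambda>m. of_real (\<Sum>r\<in>S. (cmod (v r m))\<^sup>2)) sums B2"
      using block_form_sums[OF Z, of "{..<k}" P M, OF P] unfolding gL B1_def B2_def y_def v_def by auto
    have re: "(\<lambda>m. \<Sum>r\<in>S. (cmod (y r m))\<^sup>2) sums Re B1" "(\<lambda>m. \<Sum>r\<in>S. (cmod (v r m))\<^sup>2) sums Re B2"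
      using s[THEN sums_Re] by (simp_all del: of_real_sum)
    have im: "Im B1 = 0" "Im B2 = 0"
      using s[THEN sums_Im] by (simp_all add: sums_iff del: of_real_sum)
    \<comment> \<open>The energies are needed one functional at a time, since the Toeplitz bound is
      scalar; each is dominated by the convergent total.\<close>
    have "\<exists>E. (\<lambda>m. (cmod (y r m))\<^sup>2) sums E" if "r \<in> S" for r
    proof -
      have "(cmod (y r m))\<^sup>2 \<le> (\<Sum>r\<in>S. (cmod (y r m))\<^sup>2)" for m
        using fin that by (intro member_le_sum) auto
      then have "summable (\<lambda>m. (cmod (y r m))\<^sup>2)"
        by (intro summable_comparison_test'[OF sums_summable[OF re(1)], of 0]) simp
      then show ?thesis by (simp add: summable_def)
    qed
    then obtain E where E: "\<And>r. r \<in> S \<Longrightarrow> (\<lambda>m. (cmod (y r m))\<^sup>2) sums E r" by metis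
    have "(\<lambda>m. \<Sum>r\<in>S. (cmod (y r m))\<^sup>2) sums (\<Sum>r\<in>S. E r)"
      by (intro sums_sum E)
    with re(1) have B1: "Re B1 = (\<Sum>r\<in>S. E r)" by (rule sums_unique2)
    have "(\<Sum>m<N. \<Sum>r\<in>S. (cmod (v r m))\<^sup>2) \<le> Re B1" for N
    proof -
      have "(\<Sum>m<N. (cmod (v r m))\<^sup>2) \<le> E r" if "r \<in> S" for r
      proof (rule toeplitz_bound[of c f, OF f])
        show "(\<lambda>j. c j * y r (m + j)) sums v r m" for m
        proof -
          have "(\<lambda>j. \<Sum>p\<in>S. g r p * (c j * (mat_pow Z (m + j) *v x (fst p)) $ snd p)) sums
              (\<Sum>p\<in>S. g r p * (mat_pow Z m *v (\<Lambda> *v x (fst p))) $ snd p)"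
            by (intro sums_sum sums_mult power_series_matrix_vector_sums \<Lambda>)
          then show ?thesis
            by (simp add: y_def v_def L_def sum_distrib_left mult_ac case_prod_unfold)
        qed
      qed (use E[OF that] in auto)
      then show ?thesis
        unfolding B1 by (subst sum.swap) (rule sum_mono)
    qed
    then have "Re B2 \<le> Re B1"
      using re(2) unfolding sums_def by (intro LIMSEQ_le_const2) auto
    then show ?thesis
      unfolding block_form_lyapunov B1_def[symmetric] B2_def[symmetric]
      by (simp add: complex_nonneg_Reals_iff im)
  qed
  then show "block_psd k (\<lambda>i j. (lyapunov \<Lambda> \<circ> inv (lyapunov Z)) (M i j))"
    by (simp add: block_psd_iff P_def)
qed

section \<open>The functional calculus on power series\<close>

lemma mat_mult_vec: "mat c *v x = c *s (x :: complex^'n)"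
  by (simp add: vec_eq_iff matrix_vector_mult_def mat_def if_distrib[of "\<lambda>z. z * _"] cong: if_cong)

lemma norm_vector_scalar_mult: "norm (c *s x) = cmod c * norm (x :: complex^'n)"
  by (simp add: norm_vec_def norm_mult L2_set_right_distrib)

lemma norm_axis_complex: "norm (axis j (c :: complex)) = cmod c"
  by (simp add: norm_vec_def L2_set_def axis_def if_distrib[of "\<lambda>x. (cmod x)\<^sup>2"] cong: if_cong)

section \<open>Spectrum and resolvent of a matrix\<close>

lemma matrix_inv_right: "invertible A \<Longrightarrow> A ** matrix_inv A = mat 1"
  unfolding invertible_def matrix_inv_def by (rule someI2_ex) auto

lemma spectrum_iff_det: "z \<in> spectrum A \<longleftrightarrow> det (mat z - A) = 0"
  by (simp add: spectrum_def invertible_det_nz)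

lemma spectrum_norm_le:
  assumes "z \<in> spectrum A"
  shows "cmod z \<le> onorm ((*v) A)"
proof -
  from assms have "\<not> inj ((*v) (mat z - A))"
    by (simp add: spectrum_def invertible_left_inverse matrix_left_invertible_injective)
  then obtain x where x: "x \<noteq> 0" "(mat z - A) *v x = 0"
    by (metis (no_types, lifting) eq_iff_diff_eq_0 injI matrix_vector_mult_diff_distrib)
  then have "A *v x = z *s x"
    by (simp add: matrix_vector_mult_diff_rdistrib mat_mult_vec)
  then have "cmod z * norm x \<le> onorm ((*v) A) * norm x"
    using onorm[OF bounded_linear_matrix_vector, of A x] by (simp add: norm_vector_scalar_mult)
  then show ?thesis using x by simp
qed

text \<open>Cramer's rule for column \<open>j\<close> of the inverse. It writes the entries of the
  resolvent as quotients of determinants, which makes them holomorphic off the spectrum.\<close>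

lemma matrix_inv_entry:
  fixes A :: "complex^'n^'n"
  assumes "det A \<noteq> 0"
  shows "matrix_inv A $ i $ j = det (\<chi> k l. if l = i then (if k = j then 1 else 0) else A $ k $ l) / det A"
proof -
  have "A ** matrix_inv A = mat 1"
    using assms by (meson invertible_det_nz matrix_inv_right)
  then have "A *v (matrix_inv A *v axis j 1) = axis j 1"
    by (simp add: matrix_vector_mul_assoc)
  then have "matrix_inv A *v axis j 1 = (\<chi> k. det (\<chi> i l. if l = k then axis j 1 $ i else A $ i $ l) / det A)"
    by (simp add: cramer[OF assms])
  moreover have "(matrix_inv A *v axis j 1) $ i = matrix_inv A $ i $ j"
    by (simp add: matrix_vector_mult_def axis_def if_distrib[of "\<lambda>x. _ * x"] cong: if_cong)
  ultimately have "matrix_inv A $ i $ j = det (\<chi> k l. if l = i then axis j 1 $ k else A $ k $ l) / det A"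
    by simp
  then show ?thesis by (simp add: axis_def cong: if_cong)
qed

lemma holomorphic_on_det:
  "(\<And>i j. (\<lambda>z. M z $ i $ j) holomorphic_on S) \<Longrightarrow> (\<lambda>z. det (M z)) holomorphic_on S"
  unfolding det_def by (intro holomorphic_intros)

lemma holomorphic_on_pencil: "(\<lambda>z. (mat z - A) $ i $ j) holomorphic_on S"
  by (cases "i = j") (simp_all add: mat_def holomorphic_intros)

lemma holomorphic_on_resolvent:
  fixes A :: "complex^'n^'n"
  shows "(\<lambda>z. matrix_inv (mat z - A) $ i $ j) holomorphic_on S - spectrum A"
proof -
  have "(\<lambda>z. det (\<chi> k l. if l = i then (if k = j then 1 else 0) else (mat z - A) $ k $ l) / det (mat z - A))
      holomorphic_on S - spectrum A"
  proof (intro holomorphic_on_divide holomorphic_on_det holomorphic_on_pencil)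
    show "(\<lambda>z. (\<chi> k l. if l = i then if k = j then 1 else 0 else (mat z - A) $ k $ l) $ k $ l) holomorphic_on
        S - spectrum A" for k l
      using holomorphic_on_pencil[of A k l] by (cases "l = i") (simp_all del: vector_minus_component)
  qed (simp add: spectrum_iff_det)
  then show ?thesis
    by (rule holomorphic_transform) (simp add: matrix_inv_entry spectrum_iff_det)
qed

lemma finite_spectrum: "finite (spectrum (A :: complex^'n^'n))"
proof -
  let ?p = "\<lambda>z. det (mat z - A)" and ?K = "cball 0 (onorm ((*v) A))"
  have "finite {z\<in>?K. ?p z = 0}" if "spectrum A \<noteq> {}"
  proof (intro holomorphic_compact_finite_zeros[of _ UNIV] holomorphic_on_det holomorphic_on_pencil notI)
    assume "?p constant_on UNIV"
    then obtain c where c: "\<And>z. ?p z = c" by (auto simp: constant_on_def)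
    have "of_real (onorm ((*v) A) + 1) \<notin> spectrum A"
      using spectrum_norm_le[of "of_real (onorm ((*v) A) + 1)" A] onorm_pos_le[OF bounded_linear_matrix_vector, of A]
      by (auto simp del: of_real_add)
    with c that show False by (auto simp: spectrum_iff_det)
  qed auto
  moreover have "spectrum A = {z\<in>?K. ?p z = 0}"
    using spectrum_norm_le[of _ A] by (auto simp: spectrum_iff_det)
  ultimately show ?thesis by (cases "spectrum A = {}") auto
qed

text \<open>The Neumann series. Iterating z R x = x + A R x leaves the remainder A^N R x / z^N,
  which decays geometrically.\<close>

lemma resolvent_sums:
  fixes A :: "complex^'n^'n"
  assumes "onorm ((*v) A) < cmod z"
  shows "(\<lambda>k. mat_pow A k $ i $ j / z ^ Suc k) sums (matrix_inv (mat z - A) $ i $ j)"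
proof -
  let ?R = "matrix_inv (mat z - A)" and ?q = "onorm ((*v) A)"
  have z: "z \<noteq> 0" using assms onorm_pos_le[OF bounded_linear_matrix_vector, of A] by auto
  have "det (mat z - A) \<noteq> 0"
    using spectrum_norm_le[of z A] assms by (auto simp: spectrum_iff_det)
  then have "(mat z - A) ** ?R = mat 1" by (meson invertible_det_nz matrix_inv_right)
  then have R: "(mat z - A) *v (?R *v x) = x" for x by (simp add: matrix_vector_mul_assoc)
  define x where "x = (axis j 1 :: complex^'n)"
  have r: "z *s (?R *v x) = x + A *v (?R *v x)"
    using R[of x] by (simp add: matrix_vector_mult_diff_rdistrib mat_mult_vec algebra_simps)
  have entry: "(B *v x) $ i = B $ i $ j" for B :: "complex^'n^'n"
    by (simp add: x_def matrix_vector_mult_def axis_def if_distrib[of "\<lambda>x. _ * x"] cong: if_cong)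
  have "(\<Sum>k<N. (mat_pow A k *v x) $ i / z ^ Suc k) = (?R *v x) $ i - (mat_pow A N *v (?R *v x)) $ i / z ^ N" for N
  proof (induction N)
    case (Suc N)
    have "mat_pow A N *v (z *s (?R *v x)) = mat_pow A N *v x + mat_pow A (Suc N) *v (?R *v x)"
      unfolding r mat_pow_Suc_right by (simp add: matrix_vector_right_distrib matrix_vector_mul_assoc matrix_mul_assoc)
    then have "z * (mat_pow A N *v (?R *v x)) $ i = (mat_pow A N *v x) $ i + (mat_pow A (Suc N) *v (?R *v x)) $ i"
      by (metis vector_add_component vector_scalar_commute vector_smult_component)
    then have "(mat_pow A N *v x) $ i / z ^ Suc N =
        (mat_pow A N *v (?R *v x)) $ i / z ^ N - (mat_pow A (Suc N) *v (?R *v x)) $ i / z ^ Suc N"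
      using z by (simp add: field_simps del: mat_pow.simps)
    with Suc show ?case by (simp del: mat_pow.simps)
  qed simp
  moreover have "(\<lambda>N. (?R *v x) $ i - (mat_pow A N *v (?R *v x)) $ i / z ^ N) \<longlonglongrightarrow> (?R *v x) $ i - 0"
  proof (rule tendsto_diff[OF tendsto_const Lim_null_comparison])
    show "\<forall>\<^sub>F N in sequentially. norm ((mat_pow A N *v (?R *v x)) $ i / z ^ N) \<le> (?q / cmod z) ^ N * norm (?R *v x)"
    proof (intro always_eventually allI)
      fix N
      have "norm ((mat_pow A N *v (?R *v x)) $ i) \<le> ?q ^ N * norm (?R *v x)"
        using Finite_Cartesian_Product.norm_nth_le norm_mat_pow_le order_trans by blast
      then show "norm ((mat_pow A N *v (?R *v x)) $ i / z ^ N) \<le> (?q / cmod z) ^ N * norm (?R *v x)"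
        using z by (simp add: norm_divide norm_power power_divide divide_right_mono)
    qed
    show "(\<lambda>N. (?q / cmod z) ^ N * norm (?R *v x)) \<longlonglongrightarrow> 0"
      using assms z onorm_pos_le[OF bounded_linear_matrix_vector, of A]
      by (intro tendsto_mult_left_zero LIMSEQ_realpow_zero) auto
  qed
  ultimately show ?thesis
    unfolding sums_def entry by simp
qed


text \<open>On the circle the Neumann series converges uniformly and may be integrated term by term;
  Cauchy's formula evaluates the integral of \<open>f z / z ^ Suc k\<close> as \<open>c k\<close>,
  up to the factor \<open>2 * pi * \<i>\<close>.\<close>

lemma contour_integral_resolvent_circlepath:
  fixes A :: "complex^'n^'n"
  assumes c: "\<And>z. cmod z < 1 \<Longrightarrow> (\<lambda>k. c k * z ^ k) sums f z"
    and r: "onorm ((*v) A) < r" "r < 1"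
  shows "(\<lambda>k. c k * mat_pow A k $ i $ j) sums
    (1 / (2 * of_real pi * \<i>) * contour_integral (circlepath 0 r) (\<lambda>z. f z * matrix_inv (mat z - A) $ i $ j))"
proof -
  let ?q = "onorm ((*v) A)" and ?R = "\<lambda>z. matrix_inv (mat z - A) $ i $ j" and ?C = "circlepath 0 r"
  have q: "?q \<ge> 0" by (rule onorm_pos_le[OF bounded_linear_matrix_vector])
  then have r0: "r > 0" using r by simp
  have hol: "f holomorphic_on ball 0 1"
    by (rule power_series_holomorphic[where a = c]) (simp add: c)
  \<comment> \<open>Uniqueness of the power series expansion at 0, needed because Cauchy's formula
    speaks of derivatives.\<close>
  have coeff: "(deriv ^^ k) f 0 / fact k = c k" for k
  proof -
    have "norm (1 / 2 :: complex) \<le> conv_radius c"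
      using c[of "1 / 2"] by (intro conv_radius_geI) (auto simp: sums_iff)
    then have "0 < fps_conv_radius (Abs_fps c)"
      by (simp add: fps_conv_radius_def) (metis less_ereal.simps(1) less_le_trans zero_ereal_def half_gt_zero zero_less_one)
    moreover have "eval_fps (Abs_fps c) z = f z" if "z \<in> ball 0 1" for z
      using c[of z] that by (simp add: eval_fps_def sums_iff)
    then have "\<forall>\<^sub>F z in nhds 0. eval_fps (Abs_fps c) z = f z"
      by (intro eventually_nhds_in_open[THEN eventually_mono, of "ball 0 1"]) auto
    ultimately have "f has_fps_expansion Abs_fps c"
      by (simp add: has_fps_expansion_def)
    then show ?thesis by (simp add: fps_nth_fps_expansion[symmetric])
  qed
  have cont: "continuous_on (cball 0 r) f"
    using hol r by (intro holomorphic_on_imp_continuous_on holomorphic_on_subset[OF hol]) auto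
  have int: "((\<lambda>z. f z / z ^ Suc k) has_contour_integral (2 * of_real pi * \<i>) * c k) ?C" for k
    using Cauchy_has_contour_integral_higher_derivative_circlepath[OF cont, of 0 k] r r0
      holomorphic_on_subset[OF hol, of "ball 0 r"] by (simp add: ball_subset_ball_iff coeff[symmetric])
  let ?S = "\<lambda>N z. \<Sum>k<N. mat_pow A k $ i $ j * (f z / z ^ Suc k)"
  have "((\<lambda>z. ?S N z) has_contour_integral (\<Sum>k<N. mat_pow A k $ i $ j * ((2 * of_real pi * \<i>) * c k))) ?C" for N
    by (intro has_contour_integral_sum has_contour_integral_lmul int) auto
  note S = this
  obtain B where B: "\<And>z. z \<in> sphere 0 r \<Longrightarrow> cmod (f z) \<le> B"
    using compact_imp_bounded[OF compact_continuous_image[OF continuous_on_subset[OF cont, of "sphere 0 r"]]]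
    by (force simp: bounded_iff)
  have entry: "cmod (mat_pow A k $ i $ j) \<le> ?q ^ k" for k
  proof -
    have "mat_pow A k $ i $ j = (mat_pow A k *v axis j 1) $ i"
      by (simp add: matrix_vector_mult_def axis_def if_distrib[of "\<lambda>x. _ * x"] cong: if_cong)
    also have "cmod \<dots> \<le> norm (mat_pow A k *v axis j 1)"
      by (rule Finite_Cartesian_Product.norm_nth_le)
    also have "\<dots> \<le> ?q ^ k"
      using norm_mat_pow_le[of A k "axis j 1"] by (simp add: norm_axis_complex)
    finally show ?thesis .
  qed
  have "uniform_limit (sphere 0 r) ?S (\<lambda>z. \<Sum>k. mat_pow A k $ i $ j * (f z / z ^ Suc k)) sequentially"
  proof (rule Weierstrass_m_test)
    show "norm (mat_pow A k $ i $ j * (f z / z ^ Suc k)) \<le> (?q / r) ^ k * (B / r)" if "z \<in> sphere 0 r" for k z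
    proof -
      have "norm (mat_pow A k $ i $ j * (f z / z ^ Suc k)) \<le> ?q ^ k * (B / r ^ Suc k)"
        unfolding norm_mult norm_divide norm_power using that r0 q
        by (intro mult_mono entry divide_mono B) (auto intro: order_trans[OF norm_ge_zero B])
      then show ?thesis by (simp add: power_divide mult_ac)
    qed
    show "summable (\<lambda>k. (?q / r) ^ k * (B / r))"
      using q r0 r by (intro summable_mult2 summable_geometric) auto
  qed
  moreover have "(\<Sum>k. mat_pow A k $ i $ j * (f z / z ^ Suc k)) = f z * ?R z" if "z \<in> sphere 0 r" for z
  proof -
    have "(\<lambda>k. f z * (mat_pow A k $ i $ j / z ^ Suc k)) sums (f z * ?R z)"
      using that r by (intro sums_mult resolvent_sums) auto
    then show ?thesis by (simp add: sums_iff mult_ac)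
  qed
  ultimately have u: "uniform_limit (sphere 0 r) ?S (\<lambda>z. f z * ?R z) sequentially"
    using uniform_limit_cong'[of "sphere 0 r" ?S ?S "\<lambda>z. \<Sum>k. mat_pow A k $ i $ j * (f z / z ^ Suc k)"
        "\<lambda>z. f z * ?R z" sequentially] by blast
  have "(\<lambda>N. contour_integral ?C (?S N)) \<longlonglongrightarrow> contour_integral ?C (\<lambda>z. f z * ?R z)"
    by (rule contour_integral_uniform_limit_circlepath[OF always_eventually u])
      (use S r0 in \<open>auto simp only: contour_integrable_on_def trivial_limit_sequentially\<close>)
  then have "(\<lambda>N. 1 / (2 * of_real pi * \<i>) * (\<Sum>k<N. mat_pow A k $ i $ j * ((2 * of_real pi * \<i>) * c k)))
      \<longlonglongrightarrow> 1 / (2 * of_real pi * \<i>) * contour_integral ?C (\<lambda>z. f z * ?R z)"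
    unfolding contour_integral_unique[OF S] by (intro tendsto_intros)
  also have "(\<lambda>N. 1 / (2 * of_real pi * \<i>) * (\<Sum>k<N. mat_pow A k $ i $ j * ((2 * of_real pi * \<i>) * c k))) =
      (\<lambda>N. \<Sum>k<N. c k * mat_pow A k $ i $ j)"
    by (simp add: sum_distrib_left mult_ac)
  finally show ?thesis unfolding sums_def .
qed

section \<open>Independence of the admissible contour\<close>

lemma calculus_contour_circlepath:
  assumes "onorm ((*v) A) < r" "r < 1"
  shows "calculus_contour (ball 0 1) A (circlepath 0 r)"
proof -
  have r: "r > 0" using assms onorm_pos_le[OF bounded_linear_matrix_vector, of A] by simp
  have s: "cmod w < r" if "w \<in> spectrum A" for w
    using spectrum_norm_le[OF that] assms by simp
  have "winding_number (circlepath 0 r) w = 1" if "w \<in> spectrum A" for w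
    using s[OF that] by (intro winding_number_circlepath) auto
  moreover have "winding_number (circlepath 0 r) w = 0" if "w \<notin> ball 0 1" for w
    using that r assms by (intro winding_number_zero_outside[of _ "cball 0 r"]) (auto simp: valid_path_imp_path)
  ultimately show ?thesis
    using r assms s by (force simp: calculus_contour_def)
qed

text \<open>The right-hand side does not mention \<open>\<gamma>\<close>, so all admissible contours
  give the same integral. In the residue theorem the only singularities are the finitely many points
  of the spectrum, each with winding number 1.\<close>

lemma contour_integral_resolvent:
  assumes "f holomorphic_on U" "open U" "connected U" "calculus_contour U A \<gamma>"
  shows "contour_integral \<gamma> (\<lambda>z. f z * matrix_inv (mat z - A) $ i $ j) =
    2 * pi * \<i> * (\<Sum>w\<in>spectrum A. residue (\<lambda>z. f z * matrix_inv (mat z - A) $ i $ j) w)"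
proof -
  have "contour_integral \<gamma> (\<lambda>z. f z * matrix_inv (mat z - A) $ i $ j) = 2 * pi * \<i> *
      (\<Sum>w\<in>spectrum A. winding_number \<gamma> w * residue (\<lambda>z. f z * matrix_inv (mat z - A) $ i $ j) w)"
    using assms by (intro Residue_theorem[of U] finite_spectrum holomorphic_on_mult holomorphic_on_resolvent)
      (auto simp: calculus_contour_def intro: holomorphic_on_subset)
  also have "(\<Sum>w\<in>spectrum A. winding_number \<gamma> w * residue (\<lambda>z. f z * matrix_inv (mat z - A) $ i $ j) w) =
      (\<Sum>w\<in>spectrum A. residue (\<lambda>z. f z * matrix_inv (mat z - A) $ i $ j) w)"
    using assms(4) by (intro sum.cong) (auto simp: calculus_contour_def)
  finally show ?thesis .
qed

text \<open>The contour taken by \<open>SOME\<close> is unknown; a circle shows that an admissible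
  one exists and yields the same integral. This is all that the theorem uses about the functional
  calculus.\<close>

theorem hol_calculus_sums:
  fixes A :: "complex^'n^'n"
  assumes c: "\<And>z. cmod z < 1 \<Longrightarrow> (\<lambda>k. c k * z ^ k) sums f z"
    and A: "strict_contraction A"
  shows "(\<lambda>k. c k * mat_pow A k $ i $ j) sums (hol_calculus (ball 0 1) f A $ i $ j)"
proof -
  obtain r where r: "onorm ((*v) A) < r" "r < 1"
    using A dense by (auto simp: strict_contraction_def)
  define \<gamma> where "\<gamma> = (SOME \<gamma>. calculus_contour (ball 0 1) A \<gamma>)"
  have "calculus_contour (ball 0 1) A \<gamma>"
    unfolding \<gamma>_def by (rule someI[of "calculus_contour (ball 0 1) A"], rule calculus_contour_circlepath[OF r])
  moreover have "f holomorphic_on ball 0 1"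
    by (rule power_series_holomorphic[where a = c]) (simp add: c)
  ultimately have "contour_integral \<gamma> (\<lambda>z. f z * matrix_inv (mat z - A) $ i $ j) =
      contour_integral (circlepath 0 r) (\<lambda>z. f z * matrix_inv (mat z - A) $ i $ j)"
    using calculus_contour_circlepath[OF r] by (simp add: contour_integral_resolvent)
  then show ?thesis
    using contour_integral_resolvent_circlepath[OF c r, where i = i and j = j]
    by (simp add: hol_calculus_def Let_def flip: \<gamma>_def)
qed

section \<open>Contractive extensions and transfer functions\<close>

text \<open>\<open>V\<close> is the orthogonal projection onto the range of \<open>a\<close>,
  followed by the passage from \<open>a x\<close> to \<open>b x\<close>, which is well defined since
  the kernel of \<open>a\<close> lies in that of \<open>b\<close>.\<close>

lemma contraction_extension:
  fixes a :: "'a::real_vector \<Rightarrow> 'b::euclidean_space" and b :: "'a \<Rightarrow> 'c::real_normed_vector"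
  assumes a: "linear a" and b: "linear b" and le: "\<And>x. norm (b x) \<le> norm (a x)"
  obtains V where "linear V" "\<And>x. V (a x) = b x" "\<And>e. norm (V e) \<le> norm e"
proof -
  have "\<exists>q. \<forall>x. orthogonal (e - a q) (a x)" for e
  proof -
    have sp: "span (range a) = range a"
      by (rule span_eq_iff[THEN iffD2]) (rule linear_subspace_image[OF a subspace_UNIV])
    obtain y z where "y \<in> range a" and z: "\<And>w. w \<in> range a \<Longrightarrow> orthogonal z w" "e = y + z"
      using orthogonal_subspace_decomp_exists[of "range a" e] unfolding sp by blast
    then obtain x where "y = a x" by blast
    with z show ?thesis by (intro exI[of _ x]) simp
  qed
  then obtain q where q: "\<And>e x. orthogonal (e - a (q e)) (a x)" by metis
  \<comment> \<open>The choice function \<open>q\<close> need not be linear. For a linearity defect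
    \<open>d\<close> of \<open>q\<close>, the vector \<open>a d\<close> is in the range of
    \<open>a\<close> and orthogonal to it, hence 0, and so \<open>b\<close> does not see
    \<open>d\<close>.\<close>
  have zero: "b d = 0" if "\<And>u. a d \<bullet> a u = 0" for d
    using le[of d] that[of d] by simp
  note alin = linear_diff[OF a] linear_add[OF a] linear_cmul[OF a]
    and blin = linear_diff[OF b] linear_add[OF b] linear_cmul[OF b]
  note q' = q[unfolded orthogonal_def]
  show ?thesis
  proof
    show "linear (\<lambda>e. b (q e))"
    proof (rule linearI)
      fix x y
      define d where "d = q (x + y) - q x - q y"
      have ad: "a d = (x - a (q x)) + (y - a (q y)) - (x + y - a (q (x + y)))"
        by (simp add: d_def alin)
      have "b d = 0"
        by (rule zero) (simp only: ad q' inner_diff_left[of "_ + _"] inner_add_left[of "_ - _"] diff_self add_0_left)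
      then show "b (q (x + y)) = b (q x) + b (q y)" by (simp add: d_def blin algebra_simps)
    next
      fix r x
      define d where "d = q (r *\<^sub>R x) - r *\<^sub>R q x"
      have ad: "a d = r *\<^sub>R (x - a (q x)) - (r *\<^sub>R x - a (q (r *\<^sub>R x)))"
        by (simp add: d_def alin algebra_simps)
      have "b d = 0"
        by (rule zero) (simp only: ad q' inner_diff_left[of "_ *\<^sub>R (_ - _)"] inner_scaleR_left mult_zero_right diff_self)
      then show "b (q (r *\<^sub>R x)) = r *\<^sub>R b (q x)" by (simp add: d_def blin)
    qed
    show "b (q (a x)) = b x" for x
    proof -
      have "b (x - q (a x)) = 0"
        by (rule zero) (use q' in \<open>simp add: alin\<close>)
      then show ?thesis by (simp add: blin)
    qed
    show "norm (b (q e)) \<le> norm e" for e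
    proof -
      have "(norm e)\<^sup>2 = (norm (e - a (q e)))\<^sup>2 + (norm (a (q e)))\<^sup>2"
        using norm_add_Pythagorean[OF q[of e "q e"]] by simp
      then have "(norm (a (q e)))\<^sup>2 \<le> (norm e)\<^sup>2"
        using zero_le_power2[of "norm (e - a (q e))"] by linarith
      then have "norm (a (q e)) \<le> norm e" by (rule power2_le_imp_le) simp
      with le[of "q e"] show ?thesis by simp
    qed
  qed
qed

text \<open>
  \<open>J\<close> and \<open>K\<close> play the role of multiplication by \<open>\<i>\<close>: a real-linear contractive
  extension \<open>V\<close> is made complex linear by averaging it with its conjugate \<open>- K V J\<close>.
\<close>
lemma complex_contraction_extension:
  fixes a :: "'a::real_vector \<Rightarrow> 'b::euclidean_space" and b :: "'a \<Rightarrow> 'c::real_normed_vector"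
  assumes a: "linear a" and b: "linear b" and le: "\<And>x. norm (b x) \<le> norm (a x)"
    and J: "linear J" "\<And>e. J (J e) = - e" "\<And>e. norm (J e) = norm e"
    and K: "linear K" "\<And>e. K (K e) = - e" "\<And>e. norm (K e) = norm e"
    and I: "\<And>x. a (I x) = J (a x)" "\<And>x. b (I x) = K (b x)"
  obtains V where "linear V" "\<And>x. V (a x) = b x" "\<And>e. norm (V e) \<le> norm e" "\<And>e. V (J e) = K (V e)"
proof -
  obtain W where W: "linear W" "\<And>x. W (a x) = b x" "\<And>e. norm (W e) \<le> norm e"
    using contraction_extension[OF a b le] by blast
  define V where "V = (\<lambda>e. (1/2) *\<^sub>R (W e - K (W (J e))))"
  show ?thesis
  proof
    show "linear V"
      unfolding V_def
      by (intro linearI) (simp_all add: linear_add[OF W(1)] linear_add[OF J(1)] linear_add[OF K(1)]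
          linear_cmul[OF W(1)] linear_cmul[OF J(1)] linear_cmul[OF K(1)] algebra_simps)
    show "V (a x) = b x" for x
      by (simp add: V_def I(1)[symmetric] W(2) I(2) K(2) flip: scaleR_2)
    show "norm (V e) \<le> norm e" for e
      using norm_triangle_ineq4[of "W e" "K (W (J e))"] W(3)[of e] W(3)[of "J e"]
      by (simp add: V_def J K)
    show "V (J e) = K (V e)" for e
      by (simp add: V_def J(2) K(2) linear_diff[OF K(1)] linear_cmul[OF K(1)] linear_neg[OF W(1)] linear_neg[OF K(1)])
  qed
qed

lemma norm_Pair_power2: "(norm (x, y))\<^sup>2 = (norm x)\<^sup>2 + (norm y)\<^sup>2"
  by (simp add: norm_Pair)

text \<open>Complex scalar multiplication on pairs; \<open>pair_scale \<i>\<close> will serve as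
  both \<open>J\<close> and \<open>K\<close> of the preceding extension lemma.\<close>

definition pair_scale :: "complex \<Rightarrow> (complex^'m) \<times> complex \<Rightarrow> (complex^'m) \<times> complex" where
  "pair_scale c e = (c *s fst e, c * snd e)"

lemma norm_pair_scale: "norm (pair_scale c e) = cmod c * norm e"
  by (simp add: pair_scale_def norm_prod_def norm_vector_scalar_mult norm_mult power_mult_distrib
      real_sqrt_mult flip: distrib_left)

lemma linear_pair_scale: "linear (pair_scale c)"
  by (rule linearI) (simp_all add: pair_scale_def vec_eq_iff algebra_simps)

section \<open>Transfer function of a contractive colligation\<close>

context
  fixes V :: "(complex^'m) \<times> complex \<Rightarrow> (complex^'m) \<times> complex"
  assumes lin: "linear V"
    and contr: "\<And>e. norm (V e) \<le> norm e"
    and V_i: "\<And>e. V (pair_scale \<i> e) = pair_scale \<i> (V e)"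
begin

lemma colligation_pair_scale: "V (pair_scale c e) = pair_scale c (V e)"
proof -
  have d: "pair_scale c x = Re c *\<^sub>R x + Im c *\<^sub>R pair_scale \<i> x" for x :: "(complex^'m) \<times> complex"
    by (cases c) (auto simp: pair_scale_def vec_eq_iff prod_eq_iff complex_eq_iff)
  show ?thesis
    unfolding d by (simp add: linear_add[OF lin] linear_cmul[OF lin] V_i)
qed

text \<open>Let \<open>V\<close> have blocks A, B, C, D, from state and input to state and output.
  Then \<open>state_orbit k\<close> is A^k B.\<close>

primrec state_orbit :: "nat \<Rightarrow> complex^'m" where
  "state_orbit 0 = fst (V (0, 1))"
| "state_orbit (Suc k) = fst (V (state_orbit k, 0))"

text \<open>The Markov parameters D, C B, C A B, and so on: the Taylor coefficients of the transfer
  function D + z C (1 - z A)^(-1) B.\<close>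

primrec markov :: "nat \<Rightarrow> complex" where
  "markov 0 = snd (V (0, 1))"
| "markov (Suc k) = snd (V (state_orbit k, 0))"

lemma colligation_add: "V (u + u', w) = V (u, w) + V (u', 0)"
  using linear_add[OF lin, of "(u, w)" "(u', 0)"] by simp

lemma colligation_scale: "V (c *s u, 0) = pair_scale c (V (u, 0))"
  using colligation_pair_scale[of c "(u, 0)"] by (simp add: pair_scale_def)

lemma colligation_orbit_sum: "V (\<Sum>k<N. c k *s state_orbit k, 0) = (\<Sum>k<N. c k *s state_orbit (Suc k), \<Sum>k<N. c k * markov (Suc k))"
proof (induction N)
  case 0
  then show ?case using linear_0[OF lin] by (simp add: zero_prod_def)
next
  case (Suc N)
  then show ?case by (simp add: colligation_add colligation_scale pair_scale_def)
qed

lemma colligation_split: "V (u, w) = V (u, 0) + pair_scale w (state_orbit 0, markov 0)"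
  using linear_add[OF lin, of "(u, 0)" "(0, w)"] colligation_pair_scale[of w "(0, 1)"] by (simp add: pair_scale_def)

lemma norm_fst_colligation: "norm (fst (V e)) \<le> norm e"
  using contr[of e] norm_fst_le[of "fst (V e)" "snd (V e)"] by simp

lemma norm_snd_colligation: "cmod (snd (V e)) \<le> norm e"
  using contr[of e] norm_snd_le[of "snd (V e)" "fst (V e)"] by simp

lemma norm_state_orbit_le: "norm (state_orbit k) \<le> 1"
proof (induction k)
  case 0
  show ?case using norm_fst_colligation[of "(0, 1)"] by (simp add: norm_Pair)
next
  case (Suc k)
  then show ?case using norm_fst_colligation[of "(state_orbit k, 0)"] by (simp add: norm_Pair)
qed

lemma norm_markov_le: "cmod (markov k) \<le> 1"
proof (cases k)
  case 0
  then show ?thesis using norm_snd_colligation[of "(0, 1)"] by (simp add: norm_Pair)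
next
  case (Suc l)
  then show ?thesis using norm_snd_colligation[of "(state_orbit l, 0)"] norm_state_orbit_le[of l] by (simp add: norm_Pair)
qed

lemma summable_state_orbit: "cmod z < 1 \<Longrightarrow> summable (\<lambda>k. z ^ k *s state_orbit k)"
  by (rule summable_comparison_test'[of "\<lambda>k. cmod z ^ k" 0])
    (auto simp: norm_vector_scalar_mult norm_power norm_state_orbit_le intro!: mult_left_le)

lemma summable_markov: "cmod z < 1 \<Longrightarrow> summable (\<lambda>k. markov k * z ^ k)"
  by (rule summable_comparison_test'[of "\<lambda>k. cmod z ^ k" 0])
    (auto simp: norm_mult norm_power norm_markov_le intro!: mult_left_le_one_le)

text \<open>In the limit, \<open>V (z w, 1) = (w, f z)\<close> for the orbit series \<open>w\<close>, so \<open>V\<close> contractive forces \<open>|f z| \<le> 1\<close>.\<close>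
lemma markov_series_bound:
  assumes "cmod z < 1"
  shows "cmod (\<Sum>k. markov k * z ^ k) \<le> 1"
proof -
  let ?w = "\<lambda>N. \<Sum>k<N. z ^ k *s state_orbit k" and ?f = "\<lambda>N. \<Sum>k<N. markov k * z ^ k"
  have V: "V (\<Sum>k<N. z ^ Suc k *s state_orbit k, 1) = (?w (Suc N), ?f (Suc N))" for N
    unfolding colligation_split[of _ 1] colligation_orbit_sum sum.lessThan_Suc_shift
    by (simp add: pair_scale_def mult_ac add.commute prod_eq_iff)
  have zw: "(\<Sum>k<N. z ^ Suc k *s state_orbit k) = z *s ?w N" for N
    by (simp add: vec_eq_iff sum_distrib_left mult_ac)
  have le: "(norm (?w (Suc N)))\<^sup>2 + (cmod (?f (Suc N)))\<^sup>2 \<le> (cmod z)\<^sup>2 * (norm (?w N))\<^sup>2 + 1" for N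
    using power_mono[OF contr[of "(z *s ?w N, 1)"], of 2] V[of N] unfolding zw
    by (simp add: norm_Pair_power2 norm_vector_scalar_mult power_mult_distrib)
  define W where "W = (\<Sum>k. z ^ k *s state_orbit k)"
  define F where "F = (\<Sum>k. markov k * z ^ k)"
  have w: "?w \<longlonglongrightarrow> W" and f: "?f \<longlonglongrightarrow> F"
    unfolding W_def F_def by (intro summable_LIMSEQ summable_state_orbit summable_markov assms)+
  have "(norm W)\<^sup>2 + (cmod F)\<^sup>2 \<le> (cmod z)\<^sup>2 * (norm W)\<^sup>2 + 1"
  proof (rule LIMSEQ_le)
    show "(\<lambda>N. (norm (?w (Suc N)))\<^sup>2 + (cmod (?f (Suc N)))\<^sup>2) \<longlonglongrightarrow> (norm W)\<^sup>2 + (cmod F)\<^sup>2"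
      by (intro tendsto_add tendsto_power tendsto_norm LIMSEQ_Suc w f)
    show "(\<lambda>N. (cmod z)\<^sup>2 * (norm (?w N))\<^sup>2 + 1) \<longlonglongrightarrow> (cmod z)\<^sup>2 * (norm W)\<^sup>2 + 1"
      by (intro tendsto_intros w)
  qed (use le in auto)
  moreover have "(cmod z)\<^sup>2 * (norm W)\<^sup>2 \<le> 1 * (norm W)\<^sup>2"
    using assms by (intro mult_right_mono) (auto simp: power_le_one)
  ultimately have "(cmod F)\<^sup>2 \<le> 1" by simp
  then show ?thesis
    unfolding F_def using power2_le_imp_le[of "cmod F" 1] by (simp add: F_def)
qed

text \<open>Here the index runs against time: state \<open>x (Suc n)\<close> and input
  \<open>a n\<close> produce state \<open>x n\<close> and output \<open>b n\<close>. Unrolling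
  \<open>N\<close> steps expresses \<open>x n\<close> by the inputs, up to a remainder that
  contractivity bounds by the norm of \<open>x (n + N)\<close>.\<close>

lemma markov_expansion:
  assumes "\<And>n. V (x (Suc n), a n) = (x n, b n)" "x \<longlonglongrightarrow> 0"
  shows "(\<lambda>k. markov k * a k) sums b 0"
proof -
  have rem: "norm (x n - (\<Sum>k<N. a (n + k) *s state_orbit k)) \<le> norm (x (n + N))" for n N
  proof (induction N arbitrary: n)
    case (Suc N)
    have "(x n, b n) = V (x (Suc n) - (\<Sum>k<N. a (Suc n + k) *s state_orbit k), 0)
        + V (\<Sum>k<N. a (Suc n + k) *s state_orbit k, 0) + pair_scale (a n) (state_orbit 0, markov 0)"
      using assms(1)[of n] colligation_split[of "x (Suc n)" "a n"]
        colligation_add[of "x (Suc n) - (\<Sum>k<N. a (Suc n + k) *s state_orbit k)" "\<Sum>k<N. a (Suc n + k) *s state_orbit k" 0]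
      by simp
    then have "x n = fst (V (x (Suc n) - (\<Sum>k<N. a (Suc n + k) *s state_orbit k), 0))
        + (\<Sum>k<N. a (Suc n + k) *s state_orbit (Suc k)) + a n *s state_orbit 0"
      unfolding colligation_orbit_sum by (simp add: prod_eq_iff pair_scale_def del: state_orbit.simps)
    then have "x n - (\<Sum>k<Suc N. a (n + k) *s state_orbit k) =
        fst (V (x (Suc n) - (\<Sum>k<N. a (Suc n + k) *s state_orbit k), 0))"
      unfolding sum.lessThan_Suc_shift by (simp add: algebra_simps del: state_orbit.simps)
    also have "norm \<dots> \<le> norm (x (Suc n) - (\<Sum>k<N. a (Suc n + k) *s state_orbit k))"
      using norm_fst_colligation[of "(x (Suc n) - (\<Sum>k<N. a (Suc n + k) *s state_orbit k), 0)"]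
      by (simp only: norm_Pair) simp
    also have "\<dots> \<le> norm (x (n + Suc N))" using Suc[of "Suc n"] by simp
    finally show ?case .
  qed simp
  \<comment> \<open>The input \<open>a 0\<close> reaches the output \<open>b 0\<close> directly
    through \<open>markov 0\<close>, all later ones through the state \<open>x 1\<close>; so
    \<open>rem\<close> is taken at 1.\<close>
  have "norm ((\<Sum>k<Suc N. markov k * a k) - b 0) \<le> norm (x (Suc N))" for N
  proof -
    have "(x 0, b 0) = V (x 1 - (\<Sum>k<N. a (1 + k) *s state_orbit k), 0)
        + V (\<Sum>k<N. a (1 + k) *s state_orbit k, 0) + pair_scale (a 0) (state_orbit 0, markov 0)"
      using assms(1)[of 0] colligation_split[of "x 1" "a 0"]
        colligation_add[of "x 1 - (\<Sum>k<N. a (1 + k) *s state_orbit k)" "\<Sum>k<N. a (1 + k) *s state_orbit k" 0]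
      by simp
    then have "b 0 = snd (V (x 1 - (\<Sum>k<N. a (1 + k) *s state_orbit k), 0))
        + (\<Sum>k<N. a (1 + k) * markov (Suc k)) + a 0 * markov 0"
      unfolding colligation_orbit_sum by (simp add: prod_eq_iff pair_scale_def del: markov.simps)
    then have "(\<Sum>k<Suc N. markov k * a k) - b 0 = - snd (V (x 1 - (\<Sum>k<N. a (1 + k) *s state_orbit k), 0))"
      unfolding sum.lessThan_Suc_shift by (simp add: algebra_simps del: markov.simps)
    then have "norm ((\<Sum>k<Suc N. markov k * a k) - b 0) \<le> norm (x 1 - (\<Sum>k<N. a (1 + k) *s state_orbit k))"
      using norm_snd_colligation[of "(x 1 - (\<Sum>k<N. a (1 + k) *s state_orbit k), 0)"]
      by (simp only: norm_minus_cancel norm_Pair) simp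
    with rem[of 1 N] show ?thesis by simp
  qed
  then have "(\<lambda>N. (\<Sum>k<Suc N. markov k * a k) - b 0) \<longlonglongrightarrow> 0"
    by (intro Lim_null_comparison[OF always_eventually tendsto_norm_zero[OF LIMSEQ_Suc[OF assms(2)]]]) auto
  from LIMSEQ_imp_Suc[OF LIM_zero_cancel[OF this]] show ?thesis
    unfolding sums_def .
qed

end

section \<open>Interpolation from the Choi matrix\<close>

definition matrix_unit :: "'n \<Rightarrow> 'm \<Rightarrow> complex^'m^'n" where
  "matrix_unit i j = (\<chi> s t. if s = i \<and> t = j then 1 else 0)"

lemma cinner_matrix_unit: "cinner u (matrix_unit i j *v w) = cnj (u $ i) * w $ j"
proof -
  have "(matrix_unit i j *v w) $ s = (if s = i then w $ j else 0)" for s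
    by (simp add: matrix_unit_def matrix_vector_mult_def if_distrib[of "\<lambda>x. x * _"] cong: if_cong)
  then show ?thesis
    by (simp add: cinner_def if_distrib[of "\<lambda>x. _ * x"] cong: if_cong)
qed

text \<open>Recovers a matrix from its trace functional; both the commutation with \<open>Z\<close>
  and the power series for \<open>\<Lambda>\<close> are first obtained for traces.\<close>

lemma trace_matrix_unit: "trace (A ** matrix_unit j i) = A $ i $ j"
proof -
  have "(A ** matrix_unit j i) $ s $ s = (if s = i then A $ i $ j else 0)" for s
    by (simp add: matrix_unit_def matrix_matrix_mult_def if_distrib[of "\<lambda>x. _ * x"] cong: if_cong)
  then show ?thesis by (simp add: trace_def)
qed

text \<open>The block matrix of matrix units has rank one. The map \<open>h\<close> allows indices
  that are numbers as well as elements of \<open>'n\<close>.\<close>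

lemma block_form_matrix_unit:
  "block_form I (\<lambda>i j. matrix_unit (h i) (h j)) x = of_real ((cmod (\<Sum>i\<in>I. x i $ h i))\<^sup>2)"
proof -
  have "block_form I (\<lambda>i j. matrix_unit (h i) (h j)) x = (\<Sum>j\<in>I. x j $ h j) * cnj (\<Sum>i\<in>I. x i $ h i)"
    unfolding block_form_def cinner_matrix_unit cnj_sum sum_product
    by (subst sum.swap) (simp add: mult.commute)
  then show ?thesis by (simp only: complex_norm_square)
qed

text \<open>Complete positivity at the positive block matrix of all matrix units, with
  \<open>k\<close> the dimension; the enumeration \<open>h\<close> translates between numbers and
  \<open>'n\<close>.\<close>

lemma completely_positive_choi:
  fixes \<phi> :: "complex^'n^'n \<Rightarrow> complex^'m^'m"
  assumes "completely_positive \<phi>"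
  shows "block_form UNIV (\<lambda>i j. \<phi> (matrix_unit i j)) x \<in> \<real>\<^sub>\<ge>\<^sub>0"
proof -
  obtain h where h: "bij_betw h {..<CARD('n)} (UNIV :: 'n set)"
    using ex_bij_betw_nat_finite[of "UNIV :: 'n set"] by (auto simp: lessThan_atLeast0)
  have "block_psd CARD('n) (\<lambda>i j. matrix_unit (h i) (h j))"
    unfolding block_psd_iff block_form_matrix_unit by (simp only: nonneg_Reals_of_real_iff) simp
  then have "block_psd CARD('n) (\<lambda>i j. \<phi> (matrix_unit (h i) (h j)))"
    using assms by (simp add: completely_positive_def)
  then have "block_form {..<CARD('n)} (\<lambda>i j. \<phi> (matrix_unit (h i) (h j))) (\<lambda>i. x (h i)) \<in> \<real>\<^sub>\<ge>\<^sub>0"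
    by (simp add: block_psd_iff)
  also have "block_form {..<CARD('n)} (\<lambda>i j. \<phi> (matrix_unit (h i) (h j))) (\<lambda>i. x (h i)) =
      (\<Sum>i<CARD('n). \<Sum>j\<in>UNIV. cinner (x (h i)) (\<phi> (matrix_unit (h i) j) *v x j))"
    unfolding block_form_def by (intro sum.cong refl sum.reindex_bij_betw h)
  also have "\<dots> = block_form UNIV (\<lambda>i j. \<phi> (matrix_unit i j)) x"
    unfolding block_form_def by (rule sum.reindex_bij_betw[OF h])
  finally show ?thesis .
qed

lemma matrix_vector_column: "A *v column i X = column i (A ** X)"
  by (simp add: vec_eq_iff column_def matrix_vector_mult_def matrix_matrix_mult_def)

lemma matrix_diff_distrib:
  fixes A B C :: "'a::ring_1^'n^'n"
  shows "A ** (B - C) = A ** B - A ** C" "(A - B) ** C = A ** C - B ** C"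
  by (simp_all add: vec_eq_iff matrix_matrix_mult_def algebra_simps sum_subtractf)

lemma trace_commutator_mat_pow: "trace (mat_pow Z m ** (Z ** Y - Y ** Z)) = (0 :: complex)"
proof -
  have "trace (mat_pow Z m ** (Y ** Z)) = trace (Z ** (mat_pow Z m ** Y))"
    by (metis matrix_mul_assoc trace_mul_sym)
  also have "\<dots> = trace (mat_pow Z m ** (Z ** Y))"
    by (metis matrix_mul_assoc mat_pow_commute)
  finally have "trace (mat_pow Z m ** (Y ** Z)) = trace (mat_pow Z m ** (Z ** Y))" .
  then show ?thesis unfolding matrix_diff_distrib trace_sub by (simp only: diff_self)
qed

theorem completely_positive_imp_schur_power_series:
  fixes Z \<Lambda> :: "complex^'n^'n"
  assumes Z: "strict_contraction Z"
    and cp: "completely_positive (lyapunov \<Lambda> \<circ> inv (lyapunov Z))"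
  obtains c where "\<And>z. cmod z < 1 \<Longrightarrow> summable (\<lambda>k. c k * z ^ k)"
    "\<And>z. cmod z < 1 \<Longrightarrow> cmod (\<Sum>k. c k * z ^ k) \<le> 1"
    "\<And>i j. (\<lambda>k. c k * mat_pow Z k $ i $ j) sums (\<Lambda> $ i $ j)"
proof -
  define P where "P = (\<lambda>i j :: 'n. inv (lyapunov Z) (matrix_unit i j))"
  have P: "lyapunov Z (P i j) = matrix_unit i j" for i j
    by (simp add: P_def lyapunov_inv Z)
  \<comment> \<open>A family of vectors indexed by \<open>'n\<close> is read as the columns of a
    matrix \<open>X\<close>; the square in \<open>block_form_matrix_unit\<close> then becomes the
    squared modulus of the trace of \<open>X\<close>.\<close>
  define p where "p = (\<lambda>X. Re (block_form UNIV P (\<lambda>i. column i X)))"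
  have tr: "(\<Sum>i\<in>UNIV. column i X $ i) = trace X" for X :: "complex^'n^'n"
    by (simp add: trace_def column_def)
  have "(\<lambda>m. of_real ((cmod (trace (mat_pow Z m ** X)))\<^sup>2)) sums block_form UNIV P (\<lambda>i. column i X)" for X
    using block_form_sums[OF Z, of UNIV P matrix_unit, OF P, of "\<lambda>i. column i X"]
    unfolding matrix_vector_column block_form_matrix_unit[of UNIV "\<lambda>i. i"] tr .
  from sums_Re[OF this] have p_sums: "(\<lambda>m. (cmod (trace (mat_pow Z m ** X)))\<^sup>2) sums p X" for X
    by (simp add: p_def del: of_real_power)
  have p_nonneg: "p X \<ge> 0" for X
    by (rule sums_le[OF _ sums_zero p_sums]) simp
  \<comment> \<open>The series for \<open>p (Z ** X)\<close> is the one for \<open>p X\<close>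
    without its term at 0.\<close>
  have p_step: "p X - p (Z ** X) = (cmod (trace X))\<^sup>2" for X
  proof -
    have "(\<lambda>m. (cmod (trace (mat_pow Z (Suc m) ** X)))\<^sup>2) sums p (Z ** X)"
      using p_sums[of "Z ** X"] by (simp add: mat_pow_Suc_right matrix_mul_assoc del: mat_pow.simps)
    then have "(\<lambda>m. (cmod (trace (mat_pow Z m ** X)))\<^sup>2) sums (p (Z ** X) + (cmod (trace X))\<^sup>2)"
      by (subst (asm) sums_Suc_iff) simp
    from sums_unique2[OF this p_sums[of X]] show ?thesis by simp
  qed
  define Q where "Q = (\<lambda>i j :: 'n. lyapunov \<Lambda> (P i j))"
  have Q_psd: "block_form UNIV Q x \<in> \<real>\<^sub>\<ge>\<^sub>0" for x
    using completely_positive_choi[OF cp, of x] by (simp add: Q_def P_def)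
  have Q: "Re (block_form UNIV Q (\<lambda>i. column i X)) = p X - p (\<Lambda> ** X)" for X
    by (simp add: Q_def block_form_lyapunov p_def matrix_vector_column)
  have p_le: "p (\<Lambda> ** X) \<le> p X" for X
    using Q_psd[of "\<lambda>i. column i X"] Q[of X] by (simp add: complex_nonneg_Reals_iff)
  have comm: "\<Lambda> ** Z = Z ** \<Lambda>"
  proof -
    have "trace (\<Lambda> ** (Z ** Y - Y ** Z)) = 0" for Y
    proof -
      let ?X = "Z ** Y - Y ** Z"
      have "p ?X = 0"
        using sums_unique2[OF p_sums[of ?X]] by (simp add: trace_commutator_mat_pow)
      \<comment> \<open>By \<open>p_step\<close>, the left-hand side is the term at 0 of the series
        for \<open>p (\<Lambda> ** ?X)\<close>, which is at most \<open>p ?X = 0\<close>.\<close>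
      then have "(cmod (trace (\<Lambda> ** ?X)))\<^sup>2 \<le> 0"
        using p_le[of ?X] p_step[of "\<Lambda> ** ?X"] p_nonneg[of "Z ** (\<Lambda> ** ?X)"] by linarith
      then show ?thesis by simp
    qed
    moreover have "trace (\<Lambda> ** (Z ** Y - Y ** Z)) = trace ((\<Lambda> ** Z - Z ** \<Lambda>) ** Y)" for Y
    proof -
      have "trace (\<Lambda> ** (Y ** Z)) = trace (Z ** \<Lambda> ** Y)"
        by (metis matrix_mul_assoc trace_mul_sym)
      then show ?thesis
        by (simp add: matrix_diff_distrib trace_sub matrix_mul_assoc)
    qed
    ultimately have "(\<Lambda> ** Z - Z ** \<Lambda>) $ i $ j = 0" for i j
      by (metis trace_matrix_unit)
    then show ?thesis by (simp add: vec_eq_iff)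
  qed
  obtain g :: "'n \<times> 'n \<Rightarrow> 'n \<times> 'n \<Rightarrow> complex" where g: "\<And>x. block_form UNIV Q x =
      of_real (\<Sum>r\<in>UNIV \<times> UNIV. (cmod (\<Sum>(i, s)\<in>UNIV \<times> UNIV. g r (i, s) * x i $ s))\<^sup>2)"
    using block_form_gram[OF finite Q_psd] by blast
  \<comment> \<open>The index pair (i, s) stands for entry \<open>s\<close> of column
    \<open>i\<close>, hence the order in \<open>X $ s $ i\<close>.\<close>
  define G where "G = (\<lambda>X :: complex^'n^'n. \<chi> r. \<Sum>(i, s)\<in>UNIV. g r (i, s) * X $ s $ i)"
  have norm_G: "(norm (G X))\<^sup>2 = p X - p (\<Lambda> ** X)" for X
  proof -
    have "(norm (G X))\<^sup>2 = (\<Sum>r\<in>UNIV. (cmod (\<Sum>(i, s)\<in>UNIV. g r (i, s) * X $ s $ i))\<^sup>2)"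
      by (simp add: norm_vec_def L2_set_def sum_nonneg G_def)
    also have "complex_of_real \<dots> = block_form UNIV Q (\<lambda>i. column i X)"
      unfolding g UNIV_Times_UNIV by (simp add: column_def)
    finally show ?thesis by (metis Q Re_complex_of_real)
  qed
  have G_add: "G (X + Y) = G X + G Y" for X Y
    by (simp add: G_def vec_eq_iff case_prod_unfold algebra_simps sum.distrib)
  have G_cscale: "G (cscale c X) = c *s G X" for c X
    by (simp add: G_def vec_eq_iff case_prod_unfold cscale_def map_matrix_def sum_distrib_left mult_ac)
  have trace_cscale: "trace (cscale c X) = c * trace X" for c and X :: "complex^'n^'n"
    by (simp add: trace_def cscale_def map_matrix_def sum_distrib_left)
  have scaleR_cscale: "r *\<^sub>R X = cscale (of_real r) X" for r and X :: "complex^'n^'n"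
    by (simp add: cscale_def map_matrix_def vec_eq_iff scaleR_conv_of_real[where 'a = complex])
  \<comment> \<open>\<open>V\<close> will take the state \<open>G (Z ** X)\<close> with input
    \<open>trace X\<close> to the state \<open>G X\<close> with output
    \<open>trace (\<Lambda> ** X)\<close>.\<close>
  define a where "a = (\<lambda>X. (G (Z ** X), trace X))"
  define b where "b = (\<lambda>X. (G X, trace (\<Lambda> ** X)))"
  have ab_cscale: "a (cscale c X) = pair_scale c (a X)" "b (cscale c X) = pair_scale c (b X)" for c X
    by (simp_all add: a_def b_def pair_scale_def cscale_matrix_mult G_cscale trace_cscale)
  have pair_scaleR: "pair_scale (of_real r) e = r *\<^sub>R e" for r and e :: "(complex^('n \<times> 'n)) \<times> complex"
    by (simp add: pair_scale_def prod_eq_iff vec_eq_iff scaleR_conv_of_real[where 'a = complex])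
  have lin: "linear a" "linear b"
  proof -
    have "a (X + Y) = a X + a Y" "b (X + Y) = b X + b Y" for X Y
      by (simp_all add: a_def b_def G_add trace_add matrix_add_ldistrib)
    moreover have "a (r *\<^sub>R X) = r *\<^sub>R a X" "b (r *\<^sub>R X) = r *\<^sub>R b X" for r X
      by (simp_all only: scaleR_cscale[of r X] ab_cscale pair_scaleR)
    ultimately show "linear a" "linear b" by (auto intro: linearI)
  qed
  have "(norm (b X))\<^sup>2 = (norm (a X))\<^sup>2" for X
  proof -
    have "\<Lambda> ** (Z ** X) = Z ** (\<Lambda> ** X)" by (metis comm matrix_mul_assoc)
    then show ?thesis
      using p_step[of X] p_step[of "\<Lambda> ** X"] by (simp add: a_def b_def norm_Pair_power2 norm_G)
  qed
  then have "norm (b X) \<le> norm (a X)" for X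
    by (metis norm_ge_zero order_refl power2_eq_imp_eq)
  moreover have "pair_scale \<i> (pair_scale \<i> e) = - e" for e :: "(complex^('n \<times> 'n)) \<times> complex"
    by (simp add: pair_scale_def prod_eq_iff vec_eq_iff flip: mult.assoc)
  moreover have "norm (pair_scale \<i> e) = norm e" for e :: "(complex^('n \<times> 'n)) \<times> complex"
    by (simp add: norm_pair_scale)
  ultimately obtain V where V: "linear V" "\<And>X. V (a X) = b X" "\<And>e. norm (V e) \<le> norm e"
      "\<And>e. V (pair_scale \<i> e) = pair_scale \<i> (V e)"
    using complex_contraction_extension[OF lin _ linear_pair_scale[of \<i>] _ _ linear_pair_scale[of \<i>] _ _
        ab_cscale(1)[of \<i>] ab_cscale(2)[of \<i>]] by metis
  show ?thesis
  proof (rule that[of "markov V"])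
    show "summable (\<lambda>k. markov V k * z ^ k)" "cmod (\<Sum>k. markov V k * z ^ k) \<le> 1" if "cmod z < 1" for z
      using summable_markov[OF V(1,3,4) that] markov_series_bound[OF V(1,3,4) that] by auto
    fix i j :: 'n
    let ?E = "matrix_unit j i"
    \<comment> \<open>The trajectory starting from a matrix unit E has states G(Z^n E), which tend
      to 0. Its inputs are entries of powers of \<open>Z\<close>, and its output at
      \<open>n = 0\<close> is an entry of \<open>\<Lambda>\<close>; \<open>mat_pow Z 0\<close> is
      kept to match \<open>b 0\<close>.\<close>
    have "(\<lambda>k. markov V k * trace (mat_pow Z k ** ?E)) sums trace (\<Lambda> ** (mat_pow Z 0 ** ?E))"
    proof (rule markov_expansion[OF V(1,3,4)])
      show "V (G (mat_pow Z (Suc n) ** ?E), trace (mat_pow Z n ** ?E)) =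
          (G (mat_pow Z n ** ?E), trace (\<Lambda> ** (mat_pow Z n ** ?E)))" for n
        using V(2)[of "mat_pow Z n ** ?E"] by (simp add: a_def b_def matrix_mul_assoc)
      have "(\<lambda>n. (mat_pow Z n *v column u ?E) $ s) \<longlonglongrightarrow> 0 $ s" for u s
        by (intro tendsto_vec_nth mat_pow_tendsto_0 Z)
      then have e: "(\<lambda>n. (mat_pow Z n ** ?E) $ s $ u) \<longlonglongrightarrow> 0" for u s
        by (simp add: matrix_vector_column) (simp add: column_def)
      show "(\<lambda>n. G (mat_pow Z n ** ?E)) \<longlonglongrightarrow> 0"
        unfolding G_def case_prod_unfold
        by (rule vec_tendstoI) (auto intro!: tendsto_null_sum tendsto_mult_right_zero e)
    qed
    then show "(\<lambda>k. markov V k * mat_pow Z k $ i $ j) sums (\<Lambda> $ i $ j)"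
      by (simp add: trace_matrix_unit)
  qed
qed

theorem theorem1p2:
  fixes Z \<Lambda> :: "complex^'n^'n"
  assumes "strict_contraction Z"
  shows "(\<exists>f. f analytic_on ball 0 1 \<and> f ` ball 0 1 \<subseteq> cball 0 1 \<and>
              hol_calculus (ball 0 1) f Z = \<Lambda>)
         \<longleftrightarrow> completely_positive (lyapunov \<Lambda> \<circ> inv (lyapunov Z))"
proof
  assume "\<exists>f. f analytic_on ball 0 1 \<and> f ` ball 0 1 \<subseteq> cball 0 1 \<and> hol_calculus (ball 0 1) f Z = \<Lambda>"
  then obtain f where f: "f holomorphic_on ball 0 1" "f ` ball 0 1 \<subseteq> cball 0 1"
      "hol_calculus (ball 0 1) f Z = \<Lambda>"
    by (auto simp: analytic_on_open)
  \<comment> \<open>Both directions go through power series: here the coefficients are the Taylor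
    coefficients of \<open>f\<close>, in the converse they come from the transfer function.\<close>
  have sums: "(\<lambda>k. (deriv ^^ k) f 0 / fact k * z ^ k) sums f z" if "cmod z < 1" for z
    using holomorphic_power_series[OF f(1), of z] that by simp
  show "completely_positive (lyapunov \<Lambda> \<circ> inv (lyapunov Z))"
  proof (rule schur_power_series_completely_positive[OF assms sums])
    show "cmod (f z) \<le> 1" if "cmod z < 1" for z
      using f(2) that by (force simp: image_subset_iff)
    show "(\<lambda>k. (deriv ^^ k) f 0 / fact k * mat_pow Z k $ i $ j) sums (\<Lambda> $ i $ j)" for i j
      using hol_calculus_sums[OF sums assms] unfolding f(3) .
  qed
next
  assume "completely_positive (lyapunov \<Lambda> \<circ> inv (lyapunov Z))"
  from completely_positive_imp_schur_power_series[OF assms this] obtain c where c: "\<And>z. cmod z < 1 \<Longrightarrow> summable (\<lambda>k. c k * z ^ k)"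
      "\<And>z. cmod z < 1 \<Longrightarrow> cmod (\<Sum>k. c k * z ^ k) \<le> 1"
      "\<And>i j. (\<lambda>k. c k * mat_pow Z k $ i $ j) sums (\<Lambda> $ i $ j)"
    by blast
  define f where "f = (\<lambda>z. \<Sum>k. c k * z ^ k)"
  have sums: "(\<lambda>k. c k * z ^ k) sums f z" if "cmod z < 1" for z
    unfolding f_def using c(1)[OF that] by (rule summable_sums)
  have "f analytic_on ball 0 1"
    by (rule power_series_analytic[where a = c]) (simp add: sums)
  moreover have "hol_calculus (ball 0 1) f Z = \<Lambda>"
    using sums_unique2[OF hol_calculus_sums[OF sums assms] c(3)] by (simp add: vec_eq_iff)
  ultimately show "\<exists>f. f analytic_on ball 0 1 \<and> f ` ball 0 1 \<subseteq> cball 0 1 \<and> hol_calculus (ball 0 1) f Z = \<Lambda>"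
    using c(2) by (auto simp: f_def)
qed

end
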